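(* Let $E$ be a (finite-dimensional) Euclidean space and let $\Gamma$ be a lattice in $\mathrm{Isom}(E)$, i.e. a crystallographic group. Then $\Gamma$ is exceptional if and only if $\Gamma$ is free abelian.
   Context: A group is called exceptional if for every $n\in\mathbb{N}$ any two of its subgroups of index $n$ are isomorphic as abstract groups. $\mathrm{Isom}(E)\cong \mathrm{O}(E)\ltimes E$ is the full isometry group of $E$. *)

theory Defs
  imports
    "HOL-Analysis.Analysis"
    "HOL-Algebra.Coset"
    "HOL-Algebra.Left_Coset"
    "HOL-Algebra.Free_Abelian_Groups"
begin

text \<open>
  The isometry group of a space carries the topology of pointwise convergence, that is, the
  subspace topology of the product topology that the type of functions already has. For a
  finite-dimensional Euclidean space this is the usual Lie group topology of the semidirect
  product of the orthogonal group and the translations.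
\<close>

definition isom_group :: "('a::metric_space \<Rightarrow> 'a) monoid" where
  "isom_group =
    \<lparr>carrier = {f. surj f \<and> (\<forall>x y. dist (f x) (f y) = dist x y)}, mult = (\<circ>), one = id\<rparr>"

lemma group_isom_group: "group isom_group"
proof (rule groupI)
  fix f :: "'a \<Rightarrow> 'a"
  assume "f \<in> carrier isom_group"
  then have s: "surj f" and d: "\<And>x y. dist (f x) (f y) = dist x y"
    by (auto simp: isom_group_def)
  have "inj f"
    by (rule injI) (metis d dist_eq_0_iff)
  then have "inv_into UNIV f \<circ> f = id" "surj (inv_into UNIV f)"
    by (simp_all add: inj_imp_surj_inv)
  moreover have "dist (inv_into UNIV f x) (inv_into UNIV f y) = dist x y" for x y
    using d[of "inv_into UNIV f x" "inv_into UNIV f y"] s by (simp add: surj_f_inv_f)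
  ultimately show "\<exists>g\<in>carrier isom_group. g \<otimes>\<^bsub>isom_group\<^esub> f = \<one>\<^bsub>isom_group\<^esub>"
    by (auto simp: isom_group_def)
next
  fix f g :: "'a \<Rightarrow> 'a"
  assume "f \<in> carrier isom_group" "g \<in> carrier isom_group"
  then show "f \<otimes>\<^bsub>isom_group\<^esub> g \<in> carrier isom_group"
    using comp_surj[of g f] by (simp add: isom_group_def)
qed (auto simp: isom_group_def o_assoc)

text \<open>
  The quotient topology on the space of left cosets: the preimage of a set \<open>U\<close> of cosets under the
  projection from the group is the union of \<open>U\<close>.
\<close>

definition coset_space_borel :: "('g::topological_space, 'm) monoid_scheme \<Rightarrow> 'g set \<Rightarrow> 'g set measure"
  where
  "coset_space_borel G H =
    sigma (lcosets\<^bsub>G\<^esub> H)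
      {U. U \<subseteq> lcosets\<^bsub>G\<^esub> H \<and> openin (top_of_set (carrier G)) (\<Union>U)}"

text \<open>
  A lattice is a discrete subgroup of finite covolume, i.e. one whose coset space carries a nonzero
  finite Borel measure that is invariant under left translation by the whole group.
\<close>

definition lattice_in :: "'g set \<Rightarrow> ('g::topological_space, 'm) monoid_scheme \<Rightarrow> bool" where
  "lattice_in \<Gamma> G \<longleftrightarrow>
    subgroup \<Gamma> G \<and> discrete \<Gamma> \<and>
    (\<exists>\<mu>. finite_measure \<mu> \<and> sets \<mu> = sets (coset_space_borel G \<Gamma>) \<and> emeasure \<mu> (space \<mu>) \<noteq> 0 \<and>
       (\<forall>g\<in>carrier G. \<forall>A\<in>sets \<mu>. emeasure \<mu> ((\<lambda>C. g <#\<^bsub>G\<^esub> C) ` A) = emeasure \<mu> A))"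

text \<open>
  The finiteness condition is needed because \<open>card\<close> of an infinite set is \<open>0\<close>.
\<close>

definition has_index :: "('g, 'm) monoid_scheme \<Rightarrow> 'g set \<Rightarrow> nat \<Rightarrow> bool" where
  "has_index G H n \<longleftrightarrow> finite (rcosets\<^bsub>G\<^esub> H) \<and> card (rcosets\<^bsub>G\<^esub> H) = n"

definition exceptional :: "('g, 'm) monoid_scheme \<Rightarrow> bool" where
  "exceptional G \<longleftrightarrow>
    (\<forall>n H K. subgroup H G \<and> subgroup K G \<and> has_index G H n \<and> has_index G K n \<longrightarrow>
       G\<lparr>carrier := H\<rparr> \<cong> G\<lparr>carrier := K\<rparr>)"

text \<open>
  Indexing the basis by a set of elements of the underlying type loses no generality, since a basis
  of \<open>G\<close> is itself such a set. The rank is arbitrary, possibly \<open>0\<close> or infinite.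
\<close>

definition free_abelian :: "('g, 'm) monoid_scheme \<Rightarrow> bool" where
  "free_abelian G \<longleftrightarrow> (\<exists>S::'g set. G \<cong> free_Abelian_group S)"

end

theory Submission
  imports Defs
begin

text \<open>
  A finite-index subgroup of a free abelian group is free abelian of the same rank, so free abelian groups are
  exceptional. For the converse, the invariant measure on the coset space provides elements of \<open>\<Gamma>\<close> that are
  arbitrarily close to translations in any prescribed direction (Poincare recurrence along a line of translations).
  Buser's proof of Bieberbach's theorem then shows that the translations in \<open>\<Gamma>\<close> form a normal subgroup of finite
  index that is isomorphic to a lattice spanning \<open>E\<close>, and hence is its own centralizer. If this subgroup is
  proper, then \<open>\<Gamma>\<close> has two subgroups of the same finite index of which exactly one is abelian.
\<close>

section \<open>Finite-index subgroups\<close>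

text \<open>A lattice is given by finite covolume, not by a compact quotient, so no bounded
  fundamental domain is at hand. Recurrence replaces it, but gives weaker information: the linear
  part is only close to the identity, and the error of the displacement is proportional to its
  length. Buser's argument tolerates both, since it compares only directions and ratios of lengths.
  Finite index then follows because finitely many small balls cover the orthogonal group.

  The rank of a free abelian group may be infinite here, which rules out a matrix normal form in the
  easy direction. A finite-index subgroup is treated by induction on the index, one basis element at
  a time.

  The space is an inner product space with a finite spanning set, possibly zero. Compactness of
  balls, finite nets and projections are therefore derived from an orthonormal basis.\<close>

definition cyclic_extension :: "('g, 'm) monoid_scheme \<Rightarrow> 'g set \<Rightarrow> 'g \<Rightarrow> 'g set" where
  "cyclic_extension G B h = {b \<otimes>\<^bsub>G\<^esub> h [^]\<^bsub>G\<^esub> (i::nat) | b i. b \<in> B}"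

context group
begin

lemma set_mult_rcos_subgroup:
  assumes "subgroup B G" "subgroup H G" "B \<subseteq> H" "x \<in> carrier G"
  shows "H <#> (B #> x) = H #> x"
proof -
  have "H <#> B = H"
    using assms set_mult_subgroup_idem subgroup_incl by fastforce
  then show ?thesis
    using assms setmult_rcos_assoc[of H B x] by (simp add: subgroup.subset)
qed

text \<open>This is the projection from the cosets of the smaller subgroup onto those of the larger
  one; it transfers finiteness of the index upwards.\<close>

lemma rcosets_image_of_subgroup:
  assumes "subgroup B G" "subgroup H G" "B \<subseteq> H"
  shows "rcosets H = (\<lambda>C. H <#> C) ` (rcosets B)"
  using set_mult_rcos_subgroup[OF assms] by (auto simp: RCOSETS_def image_UN)

lemma subgroup_nat_pow:
  assumes "subgroup H G" "x \<in> H" shows "x [^] (n::nat) \<in> H"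
  using assms by (induction n) (auto simp: subgroup.one_closed subgroup.m_closed)

lemma rcos_eq_iff:
  assumes "subgroup H G" "x \<in> carrier G" "y \<in> carrier G"
  shows "H #> x = H #> y \<longleftrightarrow> x \<otimes> inv y \<in> H"
proof -
  have "H #> x = H #> y \<longleftrightarrow> x \<in> H #> y"
    using repr_independence[OF _ assms(3,1)] rcos_self[OF assms(2,1)] by blast
  then show ?thesis
    using subgroup.rcos_module[OF assms(1) is_group assms(3,2)] by simp
qed

text \<open>Pigeonhole form of finite index. The colouring \<open>c\<close> must separate cosets but
  need not be constant on them, so it may be built from approximations.\<close>

lemma finite_rcosetsI:
  assumes H: "subgroup H G" and fin: "finite (c ` carrier G)"
    and c: "\<And>x y. x \<in> carrier G \<Longrightarrow> y \<in> carrier G \<Longrightarrow> c x = c y \<Longrightarrow> x \<otimes> inv y \<in> H"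
  shows "finite (rcosets H)"
proof -
  let ?r = "\<lambda>v. inv_into (carrier G) c v"
  have "rcosets H \<subseteq> (\<lambda>v. H #> ?r v) ` (c ` carrier G)"
  proof
    fix C assume "C \<in> rcosets H"
    then obtain x where x: "x \<in> carrier G" "C = H #> x" by (auto simp: RCOSETS_def)
    have r: "?r (c x) \<in> carrier G" "c (?r (c x)) = c x"
      using x by (auto intro: inv_into_into f_inv_into_f)
    have "C = H #> ?r (c x)"
      using rcos_eq_iff[OF H x(1) r(1)] c[OF x(1) r(1)] r x by simp
    then show "C \<in> (\<lambda>v. H #> ?r v) ` (c ` carrier G)" using x by blast
  qed
  then show ?thesis using fin finite_surj by blast
qed

lemma finite_rcosets_pow_mem:
  assumes H: "subgroup H G" and fin: "finite (rcosets H)" and g: "g \<in> carrier G"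
  shows "\<exists>k::nat. 0 < k \<and> g [^] k \<in> H"
proof -
  interpret H: subgroup H G by (rule H)
  have "\<not> inj (\<lambda>i::nat. H #> g [^] i)"
  proof
    assume "inj (\<lambda>i::nat. H #> g [^] i)"
    moreover have "range (\<lambda>i::nat. H #> g [^] i) \<subseteq> rcosets H"
      using g by (auto intro!: rcosetsI H.subset)
    ultimately show False using fin finite_subset range_inj_infinite by blast
  qed
  then obtain i j :: nat where ij: "i < j" "H #> g [^] i = H #> g [^] j"
    unfolding inj_def by (metis nat_neq_iff)
  have "g [^] j \<otimes> inv (g [^] i) \<in> H"
    using rcos_eq_iff[OF H, of "g [^] j" "g [^] i"] ij(2) g by simp
  moreover have "g [^] j = g [^] (j - i) \<otimes> g [^] i" using ij g by (simp add: nat_pow_mult)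
  ultimately have "g [^] (j - i) \<in> H" using g by (simp add: m_assoc)
  then show ?thesis using ij(1) by (intro exI[of _ "j - i"]) simp
qed

section \<open>Extending a subgroup by a root of one of its elements\<close>

context
  fixes B h and m :: nat
  assumes B: "subgroup B G" and h: "h \<in> carrier G"
    and normalizes: "\<And>b. b \<in> B \<Longrightarrow> h \<otimes> b \<otimes> inv h \<in> B"
    and m: "m > 0" and pow_m: "h [^] m \<in> B"
begin

interpretation B: subgroup B G by (rule B)

lemma normalizes_pow:
  assumes "b \<in> B" shows "h [^] (i::nat) \<otimes> b \<otimes> inv (h [^] i) \<in> B"
proof (induction i)
  case 0
  then show ?case using assms by simp
next
  case (Suc i)
  have "h [^] Suc i = h \<otimes> h [^] i" using h nat_pow_Suc2 by blast
  then have "h [^] Suc i \<otimes> b \<otimes> inv (h [^] Suc i) = h \<otimes> (h [^] i \<otimes> b \<otimes> inv (h [^] i)) \<otimes> inv h"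
    using h assms by (simp add: inv_mult_group m_assoc)
  then show ?case using normalizes[OF Suc] by simp
qed

lemma pow_mult_swap:
  assumes "b \<in> B" shows "\<exists>b'\<in>B. h [^] (i::nat) \<otimes> b = b' \<otimes> h [^] i"
  using normalizes_pow[OF assms, of i] assms h
  by (intro bexI[of _ "h [^] i \<otimes> b \<otimes> inv (h [^] i)"]) (auto simp: m_assoc)

lemma pow_mult_m: "h [^] (m * i) \<in> B"
proof -
  have "h [^] (m * i) = (h [^] m) [^] i" using h by (simp add: nat_pow_pow)
  then show ?thesis using pow_m B by (simp add: subgroup_nat_pow)
qed

text \<open>Natural exponents are enough even for inverses: the inverse of \<open>h [^] i\<close> is
  \<open>h [^] ((m - 1) * i)\<close> times the inverse of \<open>h [^] (m * i)\<close>, and the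
  latter factor lies in \<open>B\<close>.\<close>

lemma subgroup_cyclic_extension: "subgroup (cyclic_extension G B h) G"
proof (rule subgroupI)
  show "cyclic_extension G B h \<subseteq> carrier G"
    using h by (auto simp: cyclic_extension_def)
  show "cyclic_extension G B h \<noteq> {}"
    using B.one_closed unfolding cyclic_extension_def by blast
next
  fix x y assume "x \<in> cyclic_extension G B h" "y \<in> cyclic_extension G B h"
  then obtain b c and i j :: nat where
    xy: "b \<in> B" "x = b \<otimes> h [^] i" "c \<in> B" "y = c \<otimes> h [^] j"
    by (auto simp: cyclic_extension_def)
  obtain c' where c': "c' \<in> B" "h [^] i \<otimes> c = c' \<otimes> h [^] i"
    using pow_mult_swap[OF xy(3)] by blast
  have "x \<otimes> y = b \<otimes> (h [^] i \<otimes> c) \<otimes> h [^] j"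
    using xy h by (simp add: m_assoc)
  also have "\<dots> = (b \<otimes> c') \<otimes> h [^] (i + j)"
    using xy c' h by (simp add: m_assoc nat_pow_mult)
  finally show "x \<otimes> y \<in> cyclic_extension G B h"
    using xy c' by (auto simp: cyclic_extension_def)
next
  fix x assume "x \<in> cyclic_extension G B h"
  then obtain b and i :: nat where x: "b \<in> B" "x = b \<otimes> h [^] i"
    by (auto simp: cyclic_extension_def)
  let ?j = "(m - 1) * i"
  have sum: "?j + i = m * i" using m by (cases m) auto
  let ?d = "inv (h [^] (m * i)) \<otimes> inv b"
  have d: "?d \<in> B" using pow_mult_m x(1) by (meson B.m_closed B.m_inv_closed)
  have "inv x = inv (h [^] i) \<otimes> inv b" using x h by (simp add: inv_mult_group)
  also have "inv (h [^] i) = h [^] ?j \<otimes> inv (h [^] (m * i))"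
  proof -
    have "h [^] (m * i) = h [^] i \<otimes> h [^] ?j" using sum h by (simp add: nat_pow_mult add.commute)
    then show ?thesis using h by (simp add: inv_mult_group m_assoc[symmetric])
  qed
  finally have "inv x = h [^] ?j \<otimes> ?d" using h x by (simp add: m_assoc)
  then show "inv x \<in> cyclic_extension G B h"
    using pow_mult_swap[OF d, of ?j] by (auto simp: cyclic_extension_def)
qed

lemma subset_cyclic_extension: "B \<subseteq> cyclic_extension G B h"
  by (force simp: cyclic_extension_def intro!: exI[of _ "0::nat"])

lemma generator_in_cyclic_extension: "h \<in> cyclic_extension G B h"
  using B.one_closed h by (force simp: cyclic_extension_def intro!: exI[of _ "1::nat"] exI[of _ "\<one>"])

text \<open>Each coset of the extension splits into the \<open>m\<close> cosets of \<open>B\<close>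
  through \<open>h [^] i \<otimes> x\<close> with \<open>i < m\<close>, where \<open>x\<close> is a
  chosen representative. They are distinct because \<open>m\<close> is prime: if a smaller positive
  power of \<open>h\<close> were in \<open>B\<close>, Bezout would put \<open>h\<close> itself in
  \<open>B\<close>.\<close>

lemma card_rcosets_cyclic_extension:
  assumes prime: "prime m" and notin: "h \<notin> B"
  shows "card (rcosets B) = m * card (rcosets (cyclic_extension G B h))"
proof -
  define H where "H = cyclic_extension G B h"
  have H: "subgroup H G" unfolding H_def by (rule subgroup_cyclic_extension)
  interpret H: subgroup H G by (rule H)
  define r where "r C = (SOME x. x \<in> C)" for C :: "'a set"
  have r_mem: "r C \<in> C" if "C \<in> rcosets H" for C
    using H.rcosets_non_empty[OF that] unfolding r_def by (rule some_in_eq[THEN iffD2])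
  have r: "r C \<in> carrier G \<and> C = H #> r C" if C: "C \<in> rcosets H" for C
  proof -
    obtain x where x: "x \<in> carrier G" "C = H #> x" using C by (auto simp: RCOSETS_def)
    then show ?thesis
      using r_mem[OF C] repr_independence[OF _ x(1) H] H.elemrcos_carrier[OF is_group x(1)] by simp
  qed
  have no_small_pow: "h [^] k \<notin> B" if "0 < k" "k < m" for k :: nat
  proof
    assume k: "h [^] k \<in> B"
    have "coprime m k" using prime that by (meson nat_dvd_not_less prime_imp_coprime)
    then obtain x y where xy: "k * x = m * y + 1"
      using coprime_bezout_strong[of k m] prime by (metis coprime_commute prime_nat_iff less_numeral_extra(4))
    have "(h [^] k) [^] x \<in> B" using k B by (simp add: subgroup_nat_pow)
    then have "h [^] (m * y) \<otimes> h \<in> B" using h xy by (simp add: nat_pow_pow)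
    then have "inv (h [^] (m * y)) \<otimes> (h [^] (m * y) \<otimes> h) \<in> B"
      using pow_mult_m by (meson B.m_closed B.m_inv_closed)
    then show False using notin h by (simp add: m_assoc[symmetric])
  qed
  define \<phi> where "\<phi> = (\<lambda>(i::nat, C). B #> (h [^] i \<otimes> r C))"
  have "bij_betw \<phi> ({..<m} \<times> rcosets H) (rcosets B)"
    unfolding bij_betw_def
  proof
    show "inj_on \<phi> ({..<m} \<times> rcosets H)"
    proof (clarsimp simp: inj_on_def \<phi>_def)
      fix i C j D
      assume i: "i < m" "C \<in> rcosets H" and j: "j < m" "D \<in> rcosets H"
        and eq: "B #> (h [^] i \<otimes> r C) = B #> (h [^] j \<otimes> r D)"
      let ?x = "r C" and ?y = "r D"
      have xy: "?x \<in> carrier G" "?y \<in> carrier G" using r i j by auto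
      have b: "(h [^] i \<otimes> ?x) \<otimes> inv (h [^] j \<otimes> ?y) \<in> B" (is "?b \<in> B")
        using eq rcos_eq_iff[OF B] xy h by simp
      have hp: "h [^] k \<in> H" for k :: nat
        using generator_in_cyclic_extension H unfolding H_def[symmetric] by (simp add: subgroup_nat_pow)
      have "?x \<otimes> inv ?y = inv (h [^] i) \<otimes> ?b \<otimes> h [^] j"
        using xy h by (simp add: inv_mult_group m_assoc)
          (simp add: m_assoc[symmetric])
      moreover have "?b \<in> H" using b subset_cyclic_extension H_def by blast
      ultimately have "?x \<otimes> inv ?y \<in> H"
        using hp by (metis H.m_closed H.m_inv_closed)
      then have CD: "C = D" using r i j rcos_eq_iff[OF H] xy by metis
      have b': "h [^] i \<otimes> inv (h [^] j) \<in> B"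
        using b xy h unfolding CD by (simp add: inv_mult_group m_assoc) (simp add: m_assoc[symmetric])
      \<comment> \<open>If \<open>k < l\<close>, then \<open>h [^] (l - k)\<close> is a forbidden
        small power in \<open>B\<close>. Used in both orders, this gives
        \<open>i = j\<close>.\<close>
      have key: "l \<le> k" if "h [^] k \<otimes> inv (h [^] l) \<in> B" "l < m" "k < m" for k l :: nat
      proof (rule ccontr)
        assume "\<not> l \<le> k"
        then have kl: "k + (l - k) = l" "0 < l - k" "l - k < m" using that by auto
        have "inv (h [^] k \<otimes> inv (h [^] l)) \<in> B" using that by blast
        moreover have "h [^] l = h [^] (l - k) \<otimes> h [^] k" using kl h by (simp add: nat_pow_mult)
        ultimately have "h [^] (l - k) \<in> B"
          using h by (simp add: inv_mult_group m_assoc)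
        then show False using no_small_pow kl by blast
      qed
      have "h [^] j \<otimes> inv (h [^] i) = inv (h [^] i \<otimes> inv (h [^] j))"
        using h by (simp add: inv_mult_group)
      then have "h [^] j \<otimes> inv (h [^] i) \<in> B" using b' by simp
      then have "i = j" using key[OF b'] key[of j i] i j by (simp add: le_antisym)
      then show "i = j \<and> C = D" using CD by simp
    qed
    show "\<phi> ` ({..<m} \<times> rcosets H) = rcosets B"
    proof
      show "\<phi> ` ({..<m} \<times> rcosets H) \<subseteq> rcosets B"
        using r h by (auto simp: \<phi>_def intro!: rcosetsI B.subset)
      show "rcosets B \<subseteq> \<phi> ` ({..<m} \<times> rcosets H)"
      proof
        fix D assume "D \<in> rcosets B"
        then obtain x where x: "x \<in> carrier G" "D = B #> x" by (auto simp: RCOSETS_def)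
        let ?C = "H #> x"
        have C: "?C \<in> rcosets H" using x by (auto simp: RCOSETS_def)
        note rC = r[OF C]
        have "x \<otimes> inv (r ?C) \<in> H" using rcos_eq_iff[OF H] x rC by blast
        then obtain b i where bi: "b \<in> B" "x \<otimes> inv (r ?C) = b \<otimes> h [^] (i::nat)"
          unfolding H_def cyclic_extension_def by blast
        \<comment> \<open>Division of the exponent by \<open>m\<close>: the multiple of
          \<open>m\<close> is absorbed by \<open>B\<close>, and the remainder becomes the first
          component of the preimage.\<close>
        have i: "h [^] i = h [^] (m * (i div m)) \<otimes> h [^] (i mod m)"
          using h by (simp add: nat_pow_mult)
        let ?b' = "b \<otimes> h [^] (m * (i div m))"
        have b': "?b' \<in> B" using bi pow_mult_m by blast
        have "x = x \<otimes> inv (r ?C) \<otimes> r ?C" using x rC by (simp add: m_assoc)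
        also have "\<dots> = ?b' \<otimes> (h [^] (i mod m) \<otimes> r ?C)"
          using bi(1) rC h unfolding bi(2) i by (simp add: m_assoc)
        finally have eq: "x = ?b' \<otimes> (h [^] (i mod m) \<otimes> r ?C)" .
        have "D = B #> (h [^] (i mod m) \<otimes> r ?C)"
          unfolding x(2) using b' rC h x
          by (subst rcos_eq_iff[OF B]) (auto, subst eq, simp add: m_assoc)
        then have "D = \<phi> (i mod m, ?C)" by (simp add: \<phi>_def)
        then show "D \<in> \<phi> ` ({..<m} \<times> rcosets H)" using C m by force
      qed
    qed
  qed
  then show ?thesis
    using bij_betw_same_card[of \<phi>] by (fastforce simp: card_cartesian_product H_def)
qed

end

text \<open>Let \<open>k\<close> be the least positive exponent with \<open>g [^] k\<close> in
  \<open>A\<close>, and \<open>p\<close> a prime divisor of \<open>k\<close>. Then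
  \<open>g [^] (k div p)\<close> is outside \<open>A\<close> by minimality, and its
  \<open>p\<close>-th power is inside.\<close>

lemma prime_power_root_outside:
  assumes A: "subgroup A G" and fin: "finite (rcosets A)" and g: "g \<in> carrier G" "g \<notin> A"
  obtains h and p :: nat where "prime p" "h \<in> carrier G" "h \<notin> A" "h [^] p \<in> A"
proof -
  define k where "k = (LEAST k. 0 < k \<and> g [^] (k::nat) \<in> A)"
  have k0: "0 < k \<and> g [^] k \<in> A"
    unfolding k_def using finite_rcosets_pow_mem[OF A fin g(1)] by (rule LeastI_ex)
  have kmin: "g [^] l \<notin> A" if "0 < l" "l < k" for l :: nat
    using not_less_Least that unfolding k_def by blast
  have "k \<noteq> 1" using k0 g by auto
  then obtain p where p: "prime p" "p dvd k" by (metis prime_factor_nat)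
  define l where "l = k div p"
  have l: "l * p = k" using p by (simp add: l_def)
  then have "0 < l" "l < k" using k0 prime_gt_1_nat[OF p(1)] by (auto intro: Nat.gr0I)
  then show thesis
    using that[of p "g [^] l"] p k0 kmin g l by (simp add: nat_pow_pow)
qed

text \<open>If \<open>A \<noteq> G\<close>, choose \<open>g \<notin> A\<close> with \<open>a = g\<^sup>p \<in> A\<close> and let \<open>B\<close> be generated by \<open>a\<close> and the \<open>p\<close>-th powers in \<open>A\<close>.
  As \<open>g\<close> centralises \<open>a\<close>, the equality \<open>B = A\<close> would make all commutators of \<open>g\<close> with \<open>A\<close> infinitely
  \<open>p\<close>-divisible, so there is \<open>x \<in> A - B\<close>. The extensions of \<open>B\<close> by \<open>g\<close> and by \<open>x\<close> have the same
  index in \<open>G\<close>, but only the second one is abelian.\<close>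

theorem exceptional_imp_eq_abelian_subgroup:
  assumes A: "subgroup A G"
    and normal: "\<And>g a. g \<in> carrier G \<Longrightarrow> a \<in> A \<Longrightarrow> g \<otimes> a \<otimes> inv g \<in> A"
    and comm: "\<And>x y. x \<in> A \<Longrightarrow> y \<in> A \<Longrightarrow> x \<otimes> y = y \<otimes> x"
    and fin: "\<And>n::nat. n > 0 \<Longrightarrow> finite (rcosets ((\<lambda>x. x [^] n) ` A))"
    and torsion_free: "\<And>x n::nat. x \<in> A \<Longrightarrow> n > 0 \<Longrightarrow> x [^] n = \<one> \<Longrightarrow> x = \<one>"
    and not_divisible: "\<And>x p::nat. x \<in> A \<Longrightarrow> p > 1 \<Longrightarrow> (\<And>k::nat. \<exists>y\<in>A. x = y [^] (p ^ k)) \<Longrightarrow> x = \<one>"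
    and centralizer: "\<And>g. g \<in> carrier G \<Longrightarrow> (\<And>a. a \<in> A \<Longrightarrow> g \<otimes> a = a \<otimes> g) \<Longrightarrow> g \<in> A"
    and exceptional: "exceptional G"
  shows "A = carrier G"
proof (rule ccontr)
  interpret A: subgroup A G by (rule A)
  assume "A \<noteq> carrier G"
  then obtain g0 where g0: "g0 \<in> carrier G" "g0 \<notin> A" using A.subset by blast
  \<comment> \<open>Exponent 1 in the finiteness hypothesis says that \<open>A\<close> itself has
    finite index.\<close>
  have "(\<lambda>x. x [^] (1::nat)) ` A = A" by (auto simp: image_iff)
  then have "finite (rcosets A)" using fin[of 1] by simp
  then obtain g and p :: nat where p: "prime p" and g: "g \<in> carrier G" "g \<notin> A" "g [^] p \<in> A"
    using prime_power_root_outside[OF A _ g0] by metis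
  define a where "a = g [^] p"
  have a: "a \<in> A" "a \<in> carrier G" using g by (auto simp: a_def)
  have p0: "p > 0" "p > 1" using p prime_gt_0_nat prime_gt_1_nat by auto
  have pow_mult: "(x \<otimes> y) [^] (n::nat) = x [^] n \<otimes> y [^] n" if "x \<in> A" "y \<in> A" for x y n
    using that pow_mult_distrib[OF comm[OF that]] by simp
  have pow_A: "x [^] (n::nat) \<in> A" if "x \<in> A" for x n
    using subgroup_nat_pow[OF A that] .
  define P where "P = (\<lambda>x. x [^] p) ` A"
  have PA: "P \<subseteq> A" using pow_A by (auto simp: P_def)
  have P: "subgroup P G"
  proof (rule subgroupI)
    show "P \<subseteq> carrier G" using PA A.subset by blast
    show "P \<noteq> {}" using A.one_closed unfolding P_def by blast
    show "inv x \<in> P" if x: "x \<in> P" for x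
    proof -
      obtain y where "y \<in> A" "x = y [^] p" using x by (auto simp: P_def)
      then have "inv y \<in> A" "inv x = inv y [^] p" by (simp_all add: nat_pow_inv)
      then show ?thesis unfolding P_def by blast
    qed
    show "x \<otimes> y \<in> P" if xy: "x \<in> P" "y \<in> P" for x y
    proof -
      obtain u v where "u \<in> A" "x = u [^] p" "v \<in> A" "y = v [^] p" using xy by (auto simp: P_def)
      then have "u \<otimes> v \<in> A" "x \<otimes> y = (u \<otimes> v) [^] p" by (simp_all add: pow_mult)
      then show ?thesis unfolding P_def by blast
    qed
  qed
  have finP: "finite (rcosets P)" unfolding P_def using fin p0 by simp
  have conj_id: "x \<otimes> b \<otimes> inv x = b" if "x \<in> A" "b \<in> A" for x b
    using that comm[OF that] by (simp add: m_assoc)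
  define B where "B = cyclic_extension G P a"
  have a_norm: "a \<otimes> b \<otimes> inv a \<in> P" if "b \<in> P" for b
    using that PA conj_id a by (metis subsetD)
  have apow: "a [^] p \<in> P" using a by (auto simp: P_def)
  have B: "subgroup B G" "P \<subseteq> B" "a \<in> B"
    using subgroup_cyclic_extension[OF P a(2) a_norm p0(1) apow]
      subset_cyclic_extension[OF P a(2) a_norm p0(1) apow]
      generator_in_cyclic_extension[OF P a(2) a_norm p0(1) apow] by (auto simp: B_def)
  have BA: "B \<subseteq> A"
    using PA pow_A a by (auto simp: B_def cyclic_extension_def)
  have B_form: "\<exists>y\<in>A. \<exists>i::nat. b = y [^] p \<otimes> a [^] i" if "b \<in> B" for b
    using that by (auto simp: B_def cyclic_extension_def P_def)
  have finB: "finite (rcosets B)"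
    using rcosets_image_of_subgroup[OF P B(1,2)] finP by simp
  define c where "c x = g \<otimes> x \<otimes> inv g" for x
  have c_A: "c x \<in> A" if "x \<in> A" for x using normal g that by (simp add: c_def)
  have c_mult: "c (x \<otimes> y) = c x \<otimes> c y" if "x \<in> A" "y \<in> A" for x y
    using that g by (simp add: c_def m_assoc) (simp add: m_assoc[symmetric])
  have c_pow: "c (x [^] n) = c x [^] n" if "x \<in> A" for x and n :: nat
  proof (induction n)
    case 0
    then show ?case using g by (simp add: c_def)
  next
    case (Suc n)
    then show ?case using that pow_A c_mult by simp
  qed
  have "g \<otimes> a = a \<otimes> g" using nat_pow_Suc2[OF g(1), of p] by (simp add: a_def)
  then have c_a: "c a = a" using g(1) a by (simp add: c_def m_assoc)
  have c_eq_iff: "c x = x \<longleftrightarrow> g \<otimes> x = x \<otimes> g" if "x \<in> A" for x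
    using that g by (simp add: c_def inv_solve_right')
  \<comment> \<open>The commutator with \<open>g\<close>. Since \<open>A\<close> is abelian and
    normal, \<open>d\<close> is an endomorphism of \<open>A\<close>; it kills \<open>a\<close> and
    is trivial exactly on the elements that commute with \<open>g\<close>.\<close>
  define d where "d x = c x \<otimes> inv x" for x
  have d_A: "d x \<in> A" if "x \<in> A" for x using that c_A by (simp add: d_def)
  have d_mult: "d (x \<otimes> y) = d x \<otimes> d y" if "x \<in> A" "y \<in> A" for x y
  proof -
    have "d (x \<otimes> y) = c x \<otimes> (c y \<otimes> inv y) \<otimes> inv x"
      using that c_A by (simp add: d_def c_mult inv_mult_group m_assoc)
    also have "\<dots> = c x \<otimes> (inv x \<otimes> (c y \<otimes> inv y))"
      using that c_A comm[of "c y \<otimes> inv y" "inv x"] by (simp add: m_assoc)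
    finally show ?thesis using that c_A by (simp add: d_def m_assoc)
  qed
  have d_pow: "d (x [^] n) = d x [^] n" if "x \<in> A" for x and n :: nat
  proof (induction n)
    case 0
    then show ?case using g by (simp add: d_def c_def)
  next
    case (Suc n)
    then show ?case using that pow_A d_mult by simp
  qed
  have d_a: "d (a [^] i) = \<one>" for i :: nat
    using d_pow[OF a(1)] c_a a by (simp add: d_def)
  have d_one_iff: "d x = \<one> \<longleftrightarrow> g \<otimes> x = x \<otimes> g" if "x \<in> A" for x
    using c_eq_iff[OF that] that c_A by (simp add: d_def inv_solve_right')
  obtain x0 where x0: "x0 \<in> A" "d x0 \<noteq> \<one>"
    using centralizer[OF g(1)] g(2) d_one_iff by blast
  have "B \<noteq> A"
  proof
    assume BA: "B = A"
    have "\<exists>y\<in>A. d x = d y [^] (p ^ k)" if "x \<in> A" for x and k :: nat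
    proof (induction k)
      case 0
      then show ?case using that d_A by auto
    next
      case (Suc k)
      then obtain y where y: "y \<in> A" "d x = d y [^] (p ^ k)" by blast
      obtain z and i :: nat where z: "z \<in> A" "y = z [^] p \<otimes> a [^] i"
        using B_form y BA by blast
      have "d y = d z [^] p" using z pow_A a d_mult d_pow d_a d_A by simp
      then have "d x = d z [^] (p ^ Suc k)" using y z d_A by (simp add: nat_pow_pow)
      then show ?case using z by blast
    qed
    then have "d x0 = \<one>"
      using not_divisible[of "d x0" p] d_A x0 p0 by meson
    then show False using x0 by simp
  qed
  then obtain x where x: "x \<in> A" "x \<notin> B" using BA by blast
  have xc: "x \<in> carrier G" using x by simp
  have x_norm: "x \<otimes> b \<otimes> inv x \<in> B" if "b \<in> B" for b
    using that BA conj_id x by (metis subsetD)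
  have xpow: "x [^] p \<in> B" using x B(2) by (auto simp: P_def)
  \<comment> \<open>Conjugation by \<open>g\<close> maps \<open>p\<close>-th powers in
    \<open>A\<close> to such powers and fixes \<open>a\<close>, so it preserves
    \<open>B\<close>.\<close>
  have g_norm: "g \<otimes> b \<otimes> inv g \<in> B" if b: "b \<in> B" for b
  proof -
    obtain y and i :: nat where y: "y \<in> A" "b = y [^] p \<otimes> a [^] i" using B_form[OF b] by blast
    have "c b = c y [^] p \<otimes> a [^] i"
      using y a pow_A c_mult c_pow c_a by simp
    then show ?thesis using c_A[OF y(1)] unfolding c_def[symmetric]
      by (auto simp: B_def cyclic_extension_def P_def)
  qed
  have gpow: "g [^] p \<in> B" using B by (simp add: a_def)
  define H K where "H = cyclic_extension G B g" and "K = cyclic_extension G B x"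
  have H: "subgroup H G" "B \<subseteq> H" "g \<in> H"
    using subgroup_cyclic_extension[OF B(1) g(1) g_norm p0(1) gpow]
      subset_cyclic_extension[OF B(1) g(1) g_norm p0(1) gpow]
      generator_in_cyclic_extension[OF B(1) g(1) g_norm p0(1) gpow] by (auto simp: H_def)
  have K: "subgroup K G" "B \<subseteq> K"
    using subgroup_cyclic_extension[OF B(1) xc x_norm p0(1) xpow]
      subset_cyclic_extension[OF B(1) xc x_norm p0(1) xpow] by (auto simp: K_def)
  have "card (rcosets B) = p * card (rcosets H)"
    unfolding H_def using card_rcosets_cyclic_extension[OF B(1) g(1) g_norm p0(1) gpow p] g BA by blast
  moreover have "card (rcosets B) = p * card (rcosets K)"
    unfolding K_def using card_rcosets_cyclic_extension[OF B(1) xc x_norm p0(1) xpow p] x by blast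
  ultimately have card: "card (rcosets H) = card (rcosets K)" using p0 by simp
  moreover have "finite (rcosets H)" "finite (rcosets K)"
    using rcosets_image_of_subgroup[OF B(1)] H K finB by auto
  ultimately have "G\<lparr>carrier := H\<rparr> \<cong> G\<lparr>carrier := K\<rparr>"
    using exceptional H K unfolding exceptional_def has_index_def by metis
  then obtain f where f: "f \<in> iso (G\<lparr>carrier := H\<rparr>) (G\<lparr>carrier := K\<rparr>)"
    by (auto simp: is_iso_def)
  have f_hom: "f (u \<otimes> v) = f u \<otimes> f v" "f u \<in> K" if "u \<in> H" "v \<in> H" for u v
    using f that by (auto simp: iso_def hom_def)
  have f_inj: "inj_on f H" using f by (auto simp: iso_def bij_betw_def)
  have KA: "K \<subseteq> A" using BA x pow_A by (auto simp: K_def cyclic_extension_def)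
  \<comment> \<open>This is the witness that \<open>H\<close> is not abelian: \<open>d\<close> maps
    it to the \<open>p\<close>-th power of \<open>d x0 \<noteq> \<one>\<close>, which is nontrivial
    because \<open>A\<close> is torsion-free.\<close>
  have y: "x0 [^] p \<in> B" using x0 B(2) by (auto simp: P_def)
  then have "f (g \<otimes> x0 [^] p) = f (x0 [^] p \<otimes> g)"
    using f_hom H KA comm by (metis subsetD)
  then have "g \<otimes> x0 [^] p = x0 [^] p \<otimes> g"
    using f_inj H y by (meson inj_onD subgroup.m_closed subsetD)
  then have "d x0 [^] p = \<one>" using d_pow x0 d_one_iff pow_A by metis
  then show False using torsion_free[of "d x0" p] d_A x0 p0 by blast
qed

end

section \<open>Free abelian groups are exceptional\<close>

lemma iso_subgroup_image:
  assumes G: "group G" and K: "group K" and \<phi>: "\<phi> \<in> iso G K" and H: "subgroup H G"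
  shows "subgroup (\<phi> ` H) K"
    and "G\<lparr>carrier := H\<rparr> \<cong> K\<lparr>carrier := \<phi> ` H\<rparr>"
    and "rcosets\<^bsub>K\<^esub> (\<phi> ` H) = (`) \<phi> ` (rcosets\<^bsub>G\<^esub> H)"
proof -
  interpret group_hom G K \<phi>
    using G K \<phi> by (simp add: group_hom_def group_hom_axioms_def iso_imp_homomorphism)
  have HG: "H \<subseteq> carrier G" using H by (rule subgroup.subset)
  show "subgroup (\<phi> ` H) K" using H by (rule subgroup_img_is_subgroup)
  have "\<phi> \<in> iso (G\<lparr>carrier := H\<rparr>) (K\<lparr>carrier := \<phi> ` H\<rparr>)"
    using \<phi> HG by (auto simp: iso_def bij_betw_def hom_def inj_on_def subset_iff)
  then show "G\<lparr>carrier := H\<rparr> \<cong> K\<lparr>carrier := \<phi> ` H\<rparr>" by (rule is_isoI)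
  have "carrier K = \<phi> ` carrier G" using \<phi> by (auto simp: iso_def bij_betw_def)
  moreover have "\<phi> ` H #>\<^bsub>K\<^esub> \<phi> x = \<phi> ` (H #>\<^bsub>G\<^esub> x)" if "x \<in> carrier G" for x
    using that HG by (auto simp: r_coset_def image_iff subset_iff)
  ultimately show "rcosets\<^bsub>K\<^esub> (\<phi> ` H) = (`) \<phi> ` (rcosets\<^bsub>G\<^esub> H)"
    by (auto simp: RCOSETS_def)
qed

text \<open>The basis of the subgroup consists of a multiple of \<open>frag_of s\<close> and of the remaining basis elements, each
  corrected by a multiple of \<open>frag_of s\<close>.\<close>

lemma free_Abelian_group_subgroup_iso_of_cyclic_quotient:
  assumes H: "subgroup H (free_Abelian_group S)" and s: "s \<in> S"
    and gen: "\<And>x. Poly_Mapping.keys x \<subseteq> S \<Longrightarrow> \<exists>k. x - frag_cmul k (frag_of s) \<in> H"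
    and m: "m > 0" "frag_cmul (int m) (frag_of s) \<in> H"
  shows "(free_Abelian_group S)\<lparr>carrier := H\<rparr> \<cong> free_Abelian_group S"
proof -
  interpret H: subgroup H "free_Abelian_group S" by (rule H)
  have HS: "Poly_Mapping.keys x \<subseteq> S" if "x \<in> H" for x using H.mem_carrier[OF that] by simp
  have H_add: "x + y \<in> H" if "x \<in> H" "y \<in> H" for x y using H.m_closed[OF that] by simp
  have H_minus: "- x \<in> H" if "x \<in> H" for x using H.m_inv_closed[OF that] HS[OF that] by simp
  have H_diff: "x - y \<in> H" if "x \<in> H" "y \<in> H" for x y
    using H_add[OF that(1) H_minus[OF that(2)]] by simp
  have H_zero: "0 \<in> H" using H.one_closed by simp
  have H_cmul_nat: "frag_cmul (int n) x \<in> H" if "x \<in> H" for x n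
    by (induction n) (auto simp: H_zero frag_cmul_distrib intro: H_add that)
  have H_cmul: "frag_cmul n x \<in> H" if "x \<in> H" for x n
    using H_cmul_nat[OF that, of "nat n"] H_minus[OF H_cmul_nat[OF that, of "nat (-n)"]]
    by (cases "n \<ge> 0") (auto simp: minus_frag_cmul)
  \<comment> \<open>The order of \<open>frag_of s\<close> modulo \<open>H\<close>. The given
    \<open>m\<close> only shows that it is finite; a basis element of \<open>H\<close> needs the
    minimal multiple.\<close>
  define p where "p = (LEAST k. 0 < k \<and> frag_cmul (int k) (frag_of s) \<in> H)"
  have p: "0 < p" "frag_cmul (int p) (frag_of s) \<in> H"
    using LeastI[of "\<lambda>k. 0 < k \<and> frag_cmul (int k) (frag_of s) \<in> H" m] m by (auto simp: p_def)
  have p_min: "p \<le> k" if "0 < k" "frag_cmul (int k) (frag_of s) \<in> H" for k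
    using that unfolding p_def by (intro Least_le) simp
  obtain k where k: "\<And>t. t \<in> S \<Longrightarrow> frag_of t - frag_cmul (k t) (frag_of s) \<in> H"
  proof -
    have "\<forall>t\<in>S. \<exists>k. frag_of t - frag_cmul k (frag_of s) \<in> H" using gen by simp
    then show thesis using that bchoice[of S "\<lambda>t k. frag_of t - frag_cmul k (frag_of s) \<in> H"] by blast
  qed
  define b where "b t = (if t = s then frag_cmul (int p) (frag_of s) else frag_of t - frag_cmul (k t) (frag_of s))" for t
  have b: "b t \<in> H" if "t \<in> S" for t using that k p by (simp add: b_def)
  define \<psi> where "\<psi> = frag_extend b"
  have \<psi>_H: "\<psi> x \<in> H" if "Poly_Mapping.keys x \<subseteq> S" for x
    using that
    by (rule free_Abelian_group_induct) (auto simp: \<psi>_def H_zero b frag_extend_diff intro: H_diff)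
  \<comment> \<open>\<open>\<psi>\<close> changes only the coordinate at \<open>s\<close>. Hence
    kernel elements and the defect \<open>y - \<psi> x\<close> below are multiples of
    \<open>frag_of s\<close>.\<close>
  have lookup_\<psi>: "poly_mapping.lookup (\<psi> x) t = poly_mapping.lookup x t" if "t \<noteq> s" for x t
    using subset_UNIV[of "Poly_Mapping.keys x"] that
    by (induction x rule: frag_induction)
      (auto simp: \<psi>_def frag_extend_diff b_def lookup_minus)
  have multiple: "x = frag_cmul (poly_mapping.lookup x s) (frag_of s)" if "\<And>t. t \<noteq> s \<Longrightarrow> poly_mapping.lookup x t = 0" for x :: "'a \<Rightarrow>\<^sub>0 int"
    using that by (intro poly_mapping_eqI) auto
  have \<psi>_s: "\<psi> (frag_cmul c (frag_of s)) = frag_cmul (c * int p) (frag_of s)" for c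
    by (simp add: \<psi>_def frag_extend_cmul b_def)
  have "inj_on \<psi> (carrier (free_Abelian_group S))"
  proof (rule inj_onI)
    fix x y assume "\<psi> x = \<psi> y"
    then have z: "\<psi> (x - y) = 0" by (simp add: \<psi>_def frag_extend_diff)
    then have "poly_mapping.lookup (x - y) t = 0" if "t \<noteq> s" for t using lookup_\<psi>[OF that, of "x - y"] by simp
    then have eq: "x - y = frag_cmul (poly_mapping.lookup (x - y) s) (frag_of s)" by (rule multiple)
    then have "frag_cmul (poly_mapping.lookup (x - y) s * int p) (frag_of s) = 0" using z \<psi>_s by metis
    then have "poly_mapping.lookup (x - y) s = 0" using p by simp
    then show "x = y" using eq by simp
  qed
  moreover have "\<psi> ` carrier (free_Abelian_group S) = H"
  proof
    show "\<psi> ` carrier (free_Abelian_group S) \<subseteq> H" using \<psi>_H by auto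
    show "H \<subseteq> \<psi> ` carrier (free_Abelian_group S)"
    proof
      fix y assume y: "y \<in> H"
      define x where "x = y - frag_cmul (poly_mapping.lookup y s) (frag_of s)"
      have keys_s: "Poly_Mapping.keys (frag_cmul c (frag_of s)) \<subseteq> S" for c
        using s keys_cmul[of c "frag_of s"] by auto
      have x: "Poly_Mapping.keys x \<subseteq> S"
        using HS[OF y] keys_s keys_diff[of y "frag_cmul (poly_mapping.lookup y s) (frag_of s)"] unfolding x_def by blast
      define n where "n = poly_mapping.lookup (y - \<psi> x) s"
      have w: "y - \<psi> x \<in> H" using y \<psi>_H[OF x] by (rule H_diff)
      have "poly_mapping.lookup (y - \<psi> x) t = 0" if "t \<noteq> s" for t
        using that by (simp add: lookup_minus lookup_\<psi>) (simp add: x_def lookup_minus)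
      then have w_eq: "y - \<psi> x = frag_cmul n (frag_of s)" unfolding n_def by (rule multiple)
      \<comment> \<open>The remainder is a multiple of \<open>frag_of s\<close> in \<open>H\<close>
        below the minimal positive one, so it is 0 and the defect lies in the image of
        \<open>\<psi>\<close>.\<close>
      have "frag_cmul (n mod int p) (frag_of s)
          = frag_cmul n (frag_of s) - frag_cmul (n div int p) (frag_cmul (int p) (frag_of s))"
        by (simp add: minus_mult_div_eq_mod mult.commute flip: frag_cmul_diff_distrib)
      then have mod_H: "frag_cmul (n mod int p) (frag_of s) \<in> H"
        using H_diff H_cmul[OF p(2)] w w_eq by metis
      have "n mod int p = 0"
      proof (rule ccontr)
        assume "n mod int p \<noteq> 0"
        then have "0 < nat (n mod int p)" "nat (n mod int p) < p"
          using p(1) pos_mod_bound[of "int p" n] pos_mod_sign[of "int p" n] by linarith+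
        then show False using p_min[of "nat (n mod int p)"] mod_H by simp
      qed
      then have n: "n = (n div int p) * int p" using div_mult_mod_eq[of n "int p"] by simp
      have "\<psi> (x + frag_cmul (n div int p) (frag_of s)) = \<psi> x + frag_cmul n (frag_of s)"
        using \<psi>_s n by (metis \<psi>_def frag_extend_add)
      then have "\<psi> (x + frag_cmul (n div int p) (frag_of s)) = y" using w_eq by (simp add: algebra_simps)
      moreover have "x + frag_cmul (n div int p) (frag_of s) \<in> carrier (free_Abelian_group S)"
        using x keys_s keys_add[of x "frag_cmul (n div int p) (frag_of s)"] by auto
      ultimately show "y \<in> \<psi> ` carrier (free_Abelian_group S)" by blast
    qed
  qed
  ultimately have "\<psi> \<in> iso (free_Abelian_group S) ((free_Abelian_group S)\<lparr>carrier := H\<rparr>)"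
    by (auto simp: iso_def bij_betw_def hom_def \<psi>_def frag_extend_add)
  then show ?thesis using group.iso_sym[OF group_free_Abelian_group] is_isoI by blast
qed

text \<open>A proper subgroup \<open>H\<close> misses some basis element \<open>s\<close>; let
  \<open>K\<close> be generated by \<open>H\<close> and \<open>s\<close>. If \<open>K\<close> is
  everything, the quotient by \<open>H\<close> is cyclic and an explicit basis exists. Otherwise
  \<open>K\<close> has smaller index and is isomorphic to the whole group \<open>F\<close> by
  induction. Carrying \<open>H\<close> along this isomorphism gives a subgroup of \<open>F\<close>
  whose index is at most that of \<open>H\<close> in \<open>K\<close>, so induction applies a second
  time.\<close>

lemma free_Abelian_group_finite_index_iso:
  assumes "subgroup H (free_Abelian_group S)" "finite (rcosets\<^bsub>free_Abelian_group S\<^esub> H)"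
  shows "(free_Abelian_group S)\<lparr>carrier := H\<rparr> \<cong> free_Abelian_group S"
  using assms
proof (induction "card (rcosets\<^bsub>free_Abelian_group S\<^esub> H)" arbitrary: H rule: less_induct)
  case less
  define F where "F = free_Abelian_group S"
  note IH = less.hyps[folded F_def] and H = less.prems(1)[folded F_def] and fin = less.prems(2)[folded F_def]
  interpret F: comm_group F unfolding F_def by (rule abelian_free_Abelian_group)
  interpret H: subgroup H F by (rule H)
  have F_iff: "x \<in> carrier F \<longleftrightarrow> Poly_Mapping.keys x \<subseteq> S" for x by (simp add: F_def)
  have "F\<lparr>carrier := H\<rparr> \<cong> F"
  proof (cases "H = carrier F")
    case True
    then show ?thesis by simp
  next
    case False
    have "\<exists>s\<in>S. frag_of s \<notin> H"
    proof (rule ccontr)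
      assume gens: "\<not> (\<exists>s\<in>S. frag_of s \<notin> H)"
      have "x \<in> H" if "Poly_Mapping.keys x \<subseteq> S" for x
        using that
      proof (rule free_Abelian_group_induct)
        show "0 \<in> H" using H.one_closed by (simp add: F_def)
        show "y - z \<in> H"
          if "Poly_Mapping.keys y \<subseteq> S" "Poly_Mapping.keys z \<subseteq> S" "y \<in> H" "z \<in> H" for y z
        proof -
          have "y \<otimes>\<^bsub>F\<^esub> inv\<^bsub>F\<^esub> z \<in> H" using that by blast
          then show ?thesis using that by (simp add: F_def)
        qed
      qed (use gens in blast)
      then show False using False H.subset F_iff by blast
    qed
    then obtain s where s: "s \<in> S" "frag_of s \<notin> H" by blast
    let ?s = "frag_of s"
    have sF: "?s \<in> carrier F" using s by (simp add: F_iff)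
    obtain m :: nat where m: "0 < m" "?s [^]\<^bsub>F\<^esub> m \<in> H"
      using F.finite_rcosets_pow_mem[OF H fin sF] by blast
    have norm: "?s \<otimes>\<^bsub>F\<^esub> b \<otimes>\<^bsub>F\<^esub> inv\<^bsub>F\<^esub> ?s \<in> H" if "b \<in> H" for b
      using that sF by (simp add: F.m_comm[of ?s] F.m_assoc)
    define K where "K = cyclic_extension F H ?s"
    note ext = H sF norm m
    have K: "subgroup K F" "H \<subseteq> K" "?s \<in> K"
      using F.subgroup_cyclic_extension[OF ext] F.subset_cyclic_extension[OF ext]
        F.generator_in_cyclic_extension[OF ext] by (auto simp: K_def)
    show ?thesis
    proof (cases "K = carrier F")
      case True
      have "\<exists>k. x - frag_cmul k ?s \<in> H" if "Poly_Mapping.keys x \<subseteq> S" for x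
      proof -
        have "x \<in> K" using True that F_iff by simp
        then obtain b and i :: nat where "b \<in> H" "x = b \<otimes>\<^bsub>F\<^esub> ?s [^]\<^bsub>F\<^esub> i"
          unfolding K_def cyclic_extension_def by blast
        then have "x - frag_cmul (int i) ?s \<in> H" by (simp add: F_def)
        then show ?thesis by blast
      qed
      then show ?thesis
        using free_Abelian_group_subgroup_iso_of_cyclic_quotient[OF less.prems(1) s(1) _ m(1)] m(2)
        by (simp add: F_def)
    next
      case False
      \<comment> \<open>Projecting cosets of \<open>H\<close> to cosets of \<open>K\<close>
        identifies the coset of the unit with that of \<open>s\<close>, so the index drops.\<close>
      have card_K: "card (rcosets\<^bsub>F\<^esub> K) < card (rcosets\<^bsub>F\<^esub> H)"
      proof -
        let ?f = "\<lambda>C. K <#>\<^bsub>F\<^esub> C"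
        note f = F.set_mult_rcos_subgroup[OF H K(1,2)]
        have img: "rcosets\<^bsub>F\<^esub> K = ?f ` (rcosets\<^bsub>F\<^esub> H)" by (rule F.rcosets_image_of_subgroup[OF H K(1,2)])
        have one: "\<one>\<^bsub>F\<^esub> \<in> carrier F" by simp
        have "?f (H #>\<^bsub>F\<^esub> \<one>\<^bsub>F\<^esub>) = ?f (H #>\<^bsub>F\<^esub> ?s)"
          unfolding f[OF one] f[OF sF]
          using F.rcos_eq_iff[OF K(1) one sF] K subgroup.m_inv_closed[OF K(1,3)] sF by simp
        moreover have "H #>\<^bsub>F\<^esub> \<one>\<^bsub>F\<^esub> \<noteq> H #>\<^bsub>F\<^esub> ?s"
          using F.rcos_eq_iff[OF H sF one] s(2) sF by simp
        moreover have "H #>\<^bsub>F\<^esub> \<one>\<^bsub>F\<^esub> \<in> rcosets\<^bsub>F\<^esub> H" "H #>\<^bsub>F\<^esub> ?s \<in> rcosets\<^bsub>F\<^esub> H"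
          using one sF by (auto simp: RCOSETS_def)
        ultimately have "\<not> inj_on ?f (rcosets\<^bsub>F\<^esub> H)" by (meson inj_onD)
        then show ?thesis
          unfolding img using fin eq_card_imp_inj_on card_image_le le_neq_implies_less by blast
      qed
      have fin_K: "finite (rcosets\<^bsub>F\<^esub> K)"
        using F.rcosets_image_of_subgroup[OF H K(1,2)] fin by simp
      have "F\<lparr>carrier := K\<rparr> \<cong> F" using IH[OF card_K K(1) fin_K] .
      then obtain \<phi> where \<phi>: "\<phi> \<in> iso (F\<lparr>carrier := K\<rparr>) F" by (auto simp: is_iso_def)
      let ?K = "F\<lparr>carrier := K\<rparr>"
      have K_group: "group ?K" using K(1) by (rule F.subgroup_imp_group)
      have H_K: "subgroup H ?K" using F.subgroup_incl[OF H K(1,2)] .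
      have sub: "rcosets\<^bsub>?K\<^esub> H \<subseteq> rcosets\<^bsub>F\<^esub> H"
        using subgroup.subset[OF K(1)] by (auto simp: RCOSETS_def r_coset_def)
      \<comment> \<open>The coset of an element outside \<open>K\<close> is not a coset within
        \<open>K\<close>, hence \<open>H\<close> has smaller index in \<open>K\<close> than in
        \<open>F\<close>.\<close>
      obtain x where x: "x \<in> carrier F" "x \<notin> K" using False subgroup.subset[OF K(1)] by blast
      have "H #>\<^bsub>F\<^esub> x \<notin> rcosets\<^bsub>?K\<^esub> H"
      proof
        assume "H #>\<^bsub>F\<^esub> x \<in> rcosets\<^bsub>?K\<^esub> H"
        then have "H #>\<^bsub>F\<^esub> x \<subseteq> K"
          using group.rcosets_part_G[OF K_group H_K] by auto
        then show False using F.rcos_self[OF x(1) H] x(2) by blast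
      qed
      moreover have "H #>\<^bsub>F\<^esub> x \<in> rcosets\<^bsub>F\<^esub> H" using x(1) by (auto simp: RCOSETS_def)
      ultimately have "rcosets\<^bsub>?K\<^esub> H \<subset> rcosets\<^bsub>F\<^esub> H" using sub by blast
      then have "card (rcosets\<^bsub>?K\<^esub> H) < card (rcosets\<^bsub>F\<^esub> H)" using fin by (rule psubset_card_mono[rotated])
      moreover have fin': "finite (rcosets\<^bsub>?K\<^esub> H)" using sub fin by (rule finite_subset)
      note img = iso_subgroup_image[OF K_group F.is_group \<phi> H_K]
      have fin_img: "finite (rcosets\<^bsub>F\<^esub> (\<phi> ` H))" unfolding img(3) using fin' by simp
      have "card (rcosets\<^bsub>F\<^esub> (\<phi> ` H)) \<le> card (rcosets\<^bsub>?K\<^esub> H)"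
        unfolding img(3) using fin' by (rule card_image_le)
      ultimately have "card (rcosets\<^bsub>F\<^esub> (\<phi> ` H)) < card (rcosets\<^bsub>F\<^esub> H)" by simp
      then have "F\<lparr>carrier := \<phi> ` H\<rparr> \<cong> F" using img(1) fin_img by (rule IH)
      moreover have "F\<lparr>carrier := H\<rparr> \<cong> F\<lparr>carrier := \<phi> ` H\<rparr>" using img(2) by simp
      ultimately show ?thesis by (rule iso_trans[rotated])
    qed
  qed
  then show ?case unfolding F_def .
qed

theorem free_abelian_imp_exceptional:
  assumes G: "group G" and free: "free_abelian G"
  shows "exceptional G"
proof -
  obtain S :: "'a set" and \<phi> where \<phi>: "\<phi> \<in> iso G (free_Abelian_group S)"
    using free by (auto simp: free_abelian_def is_iso_def)
  have iso: "G\<lparr>carrier := H\<rparr> \<cong> free_Abelian_group S" if H: "subgroup H G" "has_index G H n" for H n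
  proof -
    note img = iso_subgroup_image[OF G group_free_Abelian_group \<phi> H(1)]
    have "finite (rcosets\<^bsub>free_Abelian_group S\<^esub> (\<phi> ` H))"
      unfolding img(3) using H(2) by (simp add: has_index_def)
    from free_Abelian_group_finite_index_iso[OF img(1) this] show ?thesis
      using img(2) iso_trans by blast
  qed
  show ?thesis
    unfolding exceptional_def
  proof (intro allI impI, elim conjE)
    fix n H K
    assume HK: "subgroup H G" "subgroup K G" "has_index G H n" "has_index G K n"
    have "free_Abelian_group S \<cong> G\<lparr>carrier := K\<rparr>"
      using iso[OF HK(2,4)] group.iso_sym group.subgroup_imp_group[OF G HK(2)] by blast
    then show "G\<lparr>carrier := H\<rparr> \<cong> G\<lparr>carrier := K\<rparr>"
      using iso[OF HK(1,3)] iso_trans by blast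
  qed
qed

section \<open>Finite-dimensional inner product spaces\<close>

lemma orthonormal_spanning_set:
  fixes D :: "'a::real_inner set"
  assumes "finite D"
  obtains C where "finite C" "span C = span D" "\<And>c. c \<in> C \<Longrightarrow> norm c = 1"
    "\<And>b c. b \<in> C \<Longrightarrow> c \<in> C \<Longrightarrow> b \<noteq> c \<Longrightarrow> b \<bullet> c = 0"
proof -
  obtain C0 where C0: "finite C0" "span C0 = span D" "pairwise orthogonal C0"
    using basis_orthogonal[OF assms] by blast
  define C where "C = (\<lambda>c. c /\<^sub>R norm c) ` (C0 - {0})"
  have "span C = span (C0 - {0})"
    unfolding C_def using C0(1) by (intro span_image_scale) auto
  moreover have "span (C0 - {0}) = span C0" by simp
  ultimately have span_C: "span C = span D" using C0(2) by simp
  have orth: "b \<bullet> c = 0" if bc: "b \<in> C" "c \<in> C" "b \<noteq> c" for b c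
  proof -
    obtain b0 c0 where "b0 \<in> C0" "b = b0 /\<^sub>R norm b0" "c0 \<in> C0" "c = c0 /\<^sub>R norm c0"
      using bc by (auto simp: C_def)
    then show ?thesis
      using bc(3) C0(3) by (cases "b0 = c0") (auto simp: pairwise_def orthogonal_def)
  qed
  have unit: "norm c = 1" if c: "c \<in> C" for c
  proof -
    obtain c0 where "c0 \<noteq> 0" "c = c0 /\<^sub>R norm c0" using c by (auto simp: C_def)
    then show ?thesis by simp
  qed
  have "finite C" using C0(1) by (simp add: C_def)
  from that[OF this span_C unit orth] show thesis .
qed

lemma orthonormal_expansion:
  fixes C :: "'a::real_inner set"
  assumes fin: "finite C" and unit: "\<And>c. c \<in> C \<Longrightarrow> norm c = 1"
    and orth: "\<And>b c. b \<in> C \<Longrightarrow> c \<in> C \<Longrightarrow> b \<noteq> c \<Longrightarrow> b \<bullet> c = 0"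
    and w: "w \<in> span C"
  shows "(x - (\<Sum>c\<in>C. (x \<bullet> c) *\<^sub>R c)) \<bullet> w = 0"
proof -
  have "(x - (\<Sum>c\<in>C. (x \<bullet> c) *\<^sub>R c)) \<bullet> b = 0" if b: "b \<in> C" for b
  proof -
    have "(\<Sum>c\<in>C. (x \<bullet> c) *\<^sub>R c) \<bullet> b = (\<Sum>c\<in>C. if c = b then x \<bullet> b else 0)"
      unfolding inner_sum_left
      by (rule sum.cong) (use orth[OF _ b] unit[OF b] in \<open>auto simp: dot_square_norm\<close>)
    then show ?thesis using fin b by (simp add: inner_diff_left)
  qed
  then show ?thesis using orthogonal_to_span[OF w] unfolding orthogonal_def by blast
qed

locale orthonormal_basis =
  fixes E :: "'a::real_inner set"
  assumes finite_E: "finite E" and span_E: "span E = UNIV"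
    and unit_E: "\<And>e. e \<in> E \<Longrightarrow> norm e = 1"
    and orth_E: "\<And>e f. e \<in> E \<Longrightarrow> f \<in> E \<Longrightarrow> e \<noteq> f \<Longrightarrow> e \<bullet> f = 0"
begin

lemma expansion: "x = (\<Sum>e\<in>E. (x \<bullet> e) *\<^sub>R e)"
proof -
  let ?y = "x - (\<Sum>e\<in>E. (x \<bullet> e) *\<^sub>R e)"
  have "?y \<bullet> ?y = 0"
    by (rule orthonormal_expansion[OF finite_E unit_E orth_E]) (auto simp: span_E)
  then show ?thesis by simp
qed

lemma finite_independent: "independent (B::'a set) \<Longrightarrow> finite B"
  using independent_span_bound[OF finite_E] span_E by blast

text \<open>Each coordinate of \<open>x\<close> is at most \<open>norm x\<close>. This turns
  closeness at the finitely many basis vectors, which is what pointwise convergence controls, into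
  closeness in operator norm.\<close>

lemma norm_linear_diff_le:
  fixes L M :: "'a \<Rightarrow> 'b::real_normed_vector"
  assumes "linear L" "linear M" and le: "\<And>e. e \<in> E \<Longrightarrow> norm (L e - M e) \<le> \<delta>"
  shows "norm (L x - M x) \<le> real (card E) * \<delta> * norm x"
proof -
  have "K x = (\<Sum>e\<in>E. (x \<bullet> e) *\<^sub>R K e)" if "linear K" for K :: "'a \<Rightarrow> 'b"
    by (subst expansion[of x]) (simp add: linear_sum[OF that] linear_scale[OF that])
  then have "L x - M x = (\<Sum>e\<in>E. (x \<bullet> e) *\<^sub>R (L e - M e))"
    using assms(1,2) by (simp add: sum_subtractf scaleR_diff_right)
  also have "norm \<dots> \<le> (\<Sum>e\<in>E. norm x * \<delta>)"
  proof (rule sum_norm_le)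
    fix e assume e: "e \<in> E"
    have "\<bar>x \<bullet> e\<bar> \<le> norm x" using Cauchy_Schwarz_ineq2[of x e] unit_E[OF e] by simp
    then show "norm ((x \<bullet> e) *\<^sub>R (L e - M e)) \<le> norm x * \<delta>"
      using le[OF e] by (simp add: mult_mono)
  qed
  finally show ?thesis by (simp add: algebra_simps)
qed

text \<open>The ball is a closed part of a coordinate box, and the box is a sum of finitely many
  compact segments.\<close>

lemma compact_cball_0: "compact (cball (0::'a) R)"
proof -
  have box: "compact {\<Sum>e\<in>F. c e *\<^sub>R e | c. \<forall>e\<in>F. \<bar>c e\<bar> \<le> R}" if "finite F" for F :: "'a set"
    using that
  proof (induction F rule: finite_induct)
    case empty
    have "{\<Sum>e\<in>{}. c e *\<^sub>R e | c. \<forall>e\<in>{}. \<bar>c e\<bar> \<le> R} = {0::'a}" by simp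
    then show ?case by simp
  next
    case (insert f F)
    let ?S = "(\<lambda>r. r *\<^sub>R f) ` {-R..R}" and ?T = "{\<Sum>e\<in>F. c e *\<^sub>R e | c. \<forall>e\<in>F. \<bar>c e\<bar> \<le> R}"
    have "compact ?S" by (intro compact_continuous_image continuous_intros compact_Icc)
    then have "compact {x + y | x y. x \<in> ?S \<and> y \<in> ?T}" using insert.IH by (rule compact_sums)
    moreover have "{x + y | x y. x \<in> ?S \<and> y \<in> ?T}
      = {\<Sum>e\<in>insert f F. c e *\<^sub>R e | c. \<forall>e\<in>insert f F. \<bar>c e\<bar> \<le> R}" (is "?L = ?R")
    proof
      show "?L \<subseteq> ?R"
      proof
        fix z assume "z \<in> ?L"
        then obtain r c where rc: "r \<in> {-R..R}" "\<forall>e\<in>F. \<bar>c e\<bar> \<le> R" "z = r *\<^sub>R f + (\<Sum>e\<in>F. c e *\<^sub>R e)"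
          by blast
        let ?c = "c(f := r)"
        have "(\<Sum>e\<in>F. ?c e *\<^sub>R e) = (\<Sum>e\<in>F. c e *\<^sub>R e)"
          using insert.hyps by (intro sum.cong) auto
        then have z: "z = (\<Sum>e\<in>insert f F. ?c e *\<^sub>R e)" using insert.hyps rc(3) by simp
        have bound: "\<forall>e\<in>insert f F. \<bar>?c e\<bar> \<le> R" using rc by auto
        show "z \<in> ?R" by (rule CollectI, rule exI[of _ ?c], rule conjI[OF z bound])
      qed
      show "?R \<subseteq> ?L"
      proof
        fix z assume "z \<in> ?R"
        then obtain c where c: "\<forall>e\<in>insert f F. \<bar>c e\<bar> \<le> R" "z = (\<Sum>e\<in>insert f F. c e *\<^sub>R e)" by blast
        then have z: "z = c f *\<^sub>R f + (\<Sum>e\<in>F. c e *\<^sub>R e)" using insert.hyps by simp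
        have f: "c f *\<^sub>R f \<in> ?S" using c by (intro imageI) auto
        have "(\<Sum>e\<in>F. c e *\<^sub>R e) \<in> ?T" using c(1) by (intro CollectI exI[of _ c] conjI) auto
        with z f show "z \<in> ?L" by blast
      qed
    qed
    ultimately show ?case by simp
  qed
  have "cball 0 R \<subseteq> {\<Sum>e\<in>E. c e *\<^sub>R e | c. \<forall>e\<in>E. \<bar>c e\<bar> \<le> R}"
  proof
    fix x :: 'a assume "x \<in> cball 0 R"
    then have "\<bar>x \<bullet> e\<bar> \<le> R" if "e \<in> E" for e
      using Cauchy_Schwarz_ineq2[of x e] unit_E[OF that] by simp
    then show "x \<in> {\<Sum>e\<in>E. c e *\<^sub>R e | c. \<forall>e\<in>E. \<bar>c e\<bar> \<le> R}"
      using expansion[of x] by blast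
  qed
  then show ?thesis
    using compact_Int_closed[OF box[OF finite_E] closed_cball, of 0 R] by (simp add: Int_absorb1)
qed

text \<open>\<open>d\<close> rounds every coordinate down to a multiple of \<open>\<eta>\<close>;
  the divisor \<open>card E + 1\<close> keeps the sum of the coordinate errors below
  \<open>\<epsilon>\<close>. One function serves all radii, so it can label points of the whole
  space.\<close>

lemma finite_net:
  assumes "\<epsilon> > 0"
  obtains d :: "'a \<Rightarrow> 'a" where "\<And>x. dist (d x) x < \<epsilon>" "\<And>R. finite (d ` cball 0 R)"
proof -
  define \<eta> where "\<eta> = \<epsilon> / (real (card E) + 1)"
  have \<eta>: "\<eta> > 0" using assms by (simp add: \<eta>_def add_nonneg_pos)
  define k where "k x = (\<lambda>e\<in>E. \<lfloor>(x \<bullet> e) / \<eta>\<rfloor>)" for x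
  define p where "p k = (\<Sum>e\<in>E. (of_int (k e) * \<eta>) *\<^sub>R e)" for k :: "'a \<Rightarrow> int"
  have dist: "dist (p (k x)) x < \<epsilon>" for x
  proof -
    have "p (k x) - x = (\<Sum>e\<in>E. (of_int (k x e) * \<eta> - x \<bullet> e) *\<^sub>R e)"
      unfolding p_def by (subst (2) expansion[of x]) (simp add: scaleR_diff_left sum_subtractf)
    also have "norm \<dots> \<le> (\<Sum>e\<in>E. \<eta>)"
    proof (rule sum_norm_le)
      fix e assume e: "e \<in> E"
      have "of_int \<lfloor>(x \<bullet> e) / \<eta>\<rfloor> * \<eta> \<le> x \<bullet> e" "x \<bullet> e \<le> (of_int \<lfloor>(x \<bullet> e) / \<eta>\<rfloor> + 1) * \<eta>"
        using \<eta> mult_right_mono[OF of_int_floor_le[of "(x \<bullet> e) / \<eta>"], of \<eta>]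
          mult_right_mono[OF real_of_int_floor_add_one_ge[of "(x \<bullet> e) / \<eta>"], of \<eta>] by auto
      then have "\<bar>of_int (k x e) * \<eta> - x \<bullet> e\<bar> \<le> \<eta>"
        using e by (simp add: k_def abs_le_iff algebra_simps)
      then show "norm ((of_int (k x e) * \<eta> - x \<bullet> e) *\<^sub>R e) \<le> \<eta>" using unit_E[OF e] by simp
    qed
    also have "\<dots> < \<epsilon>" using assms by (simp add: \<eta>_def field_simps)
    finally show ?thesis by (simp add: dist_norm)
  qed
  have "finite ((\<lambda>x. p (k x)) ` cball 0 R)" for R
  proof -
    have "k ` cball 0 R \<subseteq> (E \<rightarrow>\<^sub>E {- \<lceil>R / \<eta>\<rceil> - 1..\<lceil>R / \<eta>\<rceil> + 1})"
    proof
      fix v assume "v \<in> k ` cball 0 R"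
      then obtain x where x: "norm x \<le> R" "v = k x" by auto
      have "\<lfloor>(x \<bullet> e) / \<eta>\<rfloor> \<in> {- \<lceil>R / \<eta>\<rceil> - 1..\<lceil>R / \<eta>\<rceil> + 1}" if e: "e \<in> E" for e
      proof -
        have "\<bar>x \<bullet> e\<bar> \<le> R" using Cauchy_Schwarz_ineq2[of x e] unit_E[OF e] x(1) by simp
        then have "(x \<bullet> e) / \<eta> \<le> R / \<eta>" "- (R / \<eta>) \<le> (x \<bullet> e) / \<eta>"
          using \<eta> by (auto simp: field_simps abs_le_iff)
        then show ?thesis by simp linarith
      qed
      then show "v \<in> (E \<rightarrow>\<^sub>E {- \<lceil>R / \<eta>\<rceil> - 1..\<lceil>R / \<eta>\<rceil> + 1})" using x(2) by (auto simp: k_def)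
    qed
    then have "finite (k ` cball 0 R)" using finite_E by (meson finite_PiE finite_atLeastAtMost_int finite_subset)
    then have "finite (p ` k ` cball 0 R)" by (rule finite_imageI)
    then show ?thesis by (simp add: image_image)
  qed
  then show thesis using that[of "\<lambda>x. p (k x)"] dist by blast
qed

lemma orthogonal_projection_exists:
  assumes "subspace W"
  obtains P :: "'a \<Rightarrow> 'a" where "linear P" "\<And>x. P x \<in> W" "\<And>x w. w \<in> W \<Longrightarrow> (x - P x) \<bullet> w = 0"
proof -
  obtain B where B: "B \<subseteq> W" "independent B" "W \<subseteq> span B" using maximal_independent_subset by blast
  have W: "span B = W" using B assms by (metis span_minimal subset_antisym)
  obtain C where C: "finite C" "span C = span B" "\<And>c. c \<in> C \<Longrightarrow> norm c = 1"
    "\<And>b c. b \<in> C \<Longrightarrow> c \<in> C \<Longrightarrow> b \<noteq> c \<Longrightarrow> b \<bullet> c = 0"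
    using orthonormal_spanning_set[OF finite_independent[OF B(2)]] by metis
  let ?P = "\<lambda>x. \<Sum>c\<in>C. (x \<bullet> c) *\<^sub>R c"
  have "linear ?P"
    by (rule linearI) (simp_all add: inner_add_left scaleR_add_left sum.distrib scaleR_sum_right)
  moreover have "?P x \<in> W" for x
    using C(2) W by (metis (no_types, lifting) span_base span_scale span_sum)
  moreover have "(x - ?P x) \<bullet> w = 0" if "w \<in> W" for x w
    using orthonormal_expansion[OF C(1,3,4)] that C(2) W by simp
  ultimately show thesis using that by blast
qed

end

text \<open>Let \<open>N\<close> be \<open>A - id\<close> and \<open>m\<close> its operator norm,
  attained by compactness. The set \<open>W\<close> of vectors that \<open>N\<close> stretches by
  exactly \<open>m\<close> is the null set of the nonnegative quadratic form
  \<open>m\<^sup>2 * (x \<bullet> x) - N x \<bullet> N x\<close>, hence a subspace. \<open>A\<close>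
  commutes with \<open>N\<close>, so it preserves \<open>W\<close> and commutes with the projection
  \<open>P\<close> onto it. On the orthogonal complement the maximum of \<open>N\<close> over unit
  vectors is again attained, and therefore is a number \<open>m'\<close> strictly below
  \<open>m\<close>.\<close>

lemma (in orthonormal_basis) max_eigenspace_gap:
  fixes A :: "'a \<Rightarrow> 'a"
  assumes A: "orthogonal_transformation A" "surj A" and neq: "A \<noteq> id"
    and le: "\<And>x. norm (A x - x) \<le> c * norm x"
  obtains m m' P u where "linear P" "0 \<le> m'" "m' < m" "m \<le> c"
    "\<And>x. P (A x) = A (P x)" "\<And>x. norm (P x) \<le> norm x" "\<And>x. norm (x - P x) \<le> norm x"
    "\<And>x. norm (A (P x) - P x) = m * norm (P x)"
    "\<And>x. norm (A (x - P x) - (x - P x)) \<le> m' * norm (x - P x)"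
    "norm u = 1" "P u = u"
proof -
  have linA: "linear A" using A(1) by (rule orthogonal_transformation_linear)
  have innerA: "A x \<bullet> A y = x \<bullet> y" for x y using A(1) by (simp add: orthogonal_transformation_def)
  define N where "N x = A x - x" for x
  have linN: "linear N" unfolding N_def using linA linear_ident by (rule linear_compose_sub)
  have "bounded_linear N"
    by (rule bounded_linear_intro[of _ c]) (use linN le in \<open>auto simp: linear_add linear_scale mult.commute simp flip: N_def\<close>)
  then have contN: "continuous_on S (\<lambda>x. norm (N x))" for S
    by (intro continuous_on_norm linear_continuous_on)
  obtain x0 where "N x0 \<noteq> 0" using neq by (auto simp: N_def fun_eq_iff)
  then have x0: "x0 \<noteq> 0" using linear_0[OF linN] by auto
  define u0 where "u0 = x0 /\<^sub>R norm x0"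
  have u0: "norm u0 = 1" "N u0 \<noteq> 0"
    using x0 \<open>N x0 \<noteq> 0\<close> linN by (simp_all add: u0_def linear_scale)
  have attains: "\<exists>u\<in>S. norm u = 1 \<and> (\<forall>x\<in>S. norm x = 1 \<longrightarrow> norm (N x) \<le> norm (N u))"
    if "closed S" "x \<in> S" "norm x = 1" for S x
  proof -
    let ?S = "{x. norm x = 1} \<inter> S"
    have "closed {x::'a. norm x = 1}" by (intro closed_Collect_eq continuous_intros)
    then have "closed ?S" using that(1) by blast
    then have "compact (cball 0 1 \<inter> ?S)" by (rule compact_Int_closed[OF compact_cball_0])
    moreover have "cball 0 1 \<inter> ?S = ?S" by auto
    moreover have "?S \<noteq> {}" using that by blast
    ultimately show ?thesis using continuous_attains_sup[OF _ _ contN, of ?S] by auto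
  qed
  have scaled: "norm (N x) \<le> k * norm x"
    if S: "x \<in> S" "subspace S" and k: "\<And>y. y \<in> S \<Longrightarrow> norm y = 1 \<Longrightarrow> norm (N y) \<le> k" for S x k
  proof (cases "x = 0")
    case True
    then show ?thesis using linN linear_0 by simp
  next
    case False
    have "x /\<^sub>R norm x \<in> S" using S by (rule subspace_scale[rotated])
    then have "norm (N (x /\<^sub>R norm x)) \<le> k" using k False by simp
    then show ?thesis using False linN by (simp add: linear_scale field_simps)
  qed
  obtain u where u: "norm u = 1" "\<And>x. norm x = 1 \<Longrightarrow> norm (N x) \<le> norm (N u)"
    using attains[OF closed_UNIV UNIV_I u0(1)] by blast
  define m where "m = norm (N u)"
  have m: "norm (N x) \<le> m * norm x" for x
    using scaled[of x UNIV m] u(2) by (simp add: m_def)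
  have m0: "m > 0" using u(2)[OF u0(1)] u0(2) unfolding m_def by (metis less_le_trans zero_less_norm_iff)
  define W where "W = {x. norm (N x) = m * norm x}"
  define q where "q x y = m\<^sup>2 * (x \<bullet> y) - N x \<bullet> N y" for x y
  have q_add: "q (x + y) z = q x z + q y z" and q_scale: "q (r *\<^sub>R x) z = r * q x z" and q_sym: "q x y = q y x"
    for x y z r
    using linN by (simp_all add: q_def linear_add linear_scale algebra_simps inner_commute)
  have q_nonneg: "q x x \<ge> 0" for x
  proof -
    have "(norm (N x))\<^sup>2 \<le> (m * norm x)\<^sup>2" using m by (intro power_mono) auto
    then show ?thesis by (simp add: q_def power2_norm_eq_inner power_mult_distrib)
  qed
  have W_q: "x \<in> W \<longleftrightarrow> q x x = 0" for x
  proof -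
    have "x \<in> W \<longleftrightarrow> (norm (N x))\<^sup>2 = (m * norm x)\<^sup>2"
      using m0 by (auto simp: W_def power2_eq_iff_nonneg)
    then show ?thesis by (auto simp: q_def power2_norm_eq_inner power_mult_distrib)
  qed
  \<comment> \<open>A null vector of a nonnegative form lies in its radical. Otherwise
    \<open>q\<close> at \<open>t *\<^sub>R x + y\<close> is affine in \<open>t\<close> with nonzero
    slope, and the chosen \<open>t\<close> gives it the value -1.\<close>
  have q_zero: "q x y = 0" if "q x x = 0" for x y
  proof (rule ccontr)
    assume ne: "q x y \<noteq> 0"
    define t where "t = - (q y y + 1) / (2 * q x y)"
    have "q z (t *\<^sub>R x + y) = t * q x z + q y z" for z
      using q_sym[of z "t *\<^sub>R x + y"] by (simp add: q_add q_scale)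
    then have "q (t *\<^sub>R x + y) (t *\<^sub>R x + y) = t * (t * q x x + q y x) + (t * q x y + q y y)"
      unfolding q_add[of _ y] q_scale by simp
    then have "q (t *\<^sub>R x + y) (t *\<^sub>R x + y) = t\<^sup>2 * q x x + 2 * t * q x y + q y y"
      by (simp add: q_sym[of y x] power2_eq_square algebra_simps)
    also have "\<dots> = -1" using that ne by (simp add: t_def field_simps)
    finally show False using q_nonneg[of "t *\<^sub>R x + y"] by simp
  qed
  have subW: "subspace W"
    unfolding subspace_def
  proof (intro conjI ballI allI)
    show "0 \<in> W" using linN linear_0 by (simp add: W_def)
    show "x + y \<in> W" if "x \<in> W" "y \<in> W" for x y
      using that q_zero[of x] q_zero[of y] by (simp add: W_q q_add)
    show "r *\<^sub>R x \<in> W" if "x \<in> W" for x r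
      using that q_zero[of x] by (simp add: W_q q_scale)
  qed
  have A_W: "A x \<in> W \<longleftrightarrow> x \<in> W" for x
  proof -
    have "N (A x) = A (N x)" using linA by (simp add: N_def linear_diff)
    then show ?thesis using A(1) by (simp add: W_def orthogonal_transformation_norm)
  qed
  obtain P where P: "linear P" "\<And>x. P x \<in> W" "\<And>x w. w \<in> W \<Longrightarrow> (x - P x) \<bullet> w = 0"
    using orthogonal_projection_exists[OF subW] by metis
  have P_unique: "P x = w" if "w \<in> W" "\<And>v. v \<in> W \<Longrightarrow> (x - w) \<bullet> v = 0" for x w
  proof -
    have "P x - w \<in> W" using P(2) that(1) subW by (simp add: subspace_diff)
    then have "(x - w) \<bullet> (P x - w) = 0" "(x - P x) \<bullet> (P x - w) = 0" using that(2) P(3) by auto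
    then have "(P x - w) \<bullet> (P x - w) = 0" by (simp add: algebra_simps)
    then show ?thesis by simp
  qed
  have PA: "P (A x) = A (P x)" for x
  proof (rule P_unique)
    show "A (P x) \<in> W" using A_W P(2) by blast
    fix v assume v: "v \<in> W"
    obtain w where w: "v = A w" using A(2) by blast
    then have "(x - P x) \<bullet> w = 0" using v A_W P(3) by blast
    then show "(A x - A (P x)) \<bullet> v = 0" using linA w innerA by (metis linear_diff)
  qed
  have pyth: "(norm x)\<^sup>2 = (norm (P x))\<^sup>2 + (norm (x - P x))\<^sup>2" for x
  proof -
    have "orthogonal (P x) (x - P x)"
      unfolding orthogonal_def by (subst inner_commute) (rule P(3)[OF P(2)])
    from norm_add_Pythagorean[OF this] show ?thesis by simp
  qed
  have normP: "norm (P x) \<le> norm x" "norm (x - P x) \<le> norm x" for x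
    by (rule power2_le_imp_le; simp add: pyth[of x])+
  define W' where "W' = {x. \<forall>w\<in>W. x \<bullet> w = 0}"
  have W': "x - P x \<in> W'" for x using P(3) by (simp add: W'_def)
  have subW': "subspace W'" by (auto simp: subspace_def W'_def inner_add_left)
  have closedW': "closed W'"
  proof -
    have "W' = (\<Inter>w\<in>W. {x. x \<bullet> w = 0})" by (auto simp: W'_def)
    moreover have "closed {x. x \<bullet> w = 0}" for w :: 'a
      by (intro closed_Collect_eq continuous_intros)
    ultimately show ?thesis by auto
  qed
  obtain m' where m': "0 \<le> m'" "m' < m" "\<And>y. y \<in> W' \<Longrightarrow> norm y = 1 \<Longrightarrow> norm (N y) \<le> m'"
  proof (cases "\<exists>y\<in>W'. norm y = 1")
    \<comment> \<open>The complement is trivial, and 0 serves as the bound.\<close>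
    case False
    then have "norm (N y) \<le> 0" if "y \<in> W'" "norm y = 1" for y using that by blast
    then show thesis by (rule that[OF order_refl m0])
  next
    case True
    then obtain z where z: "z \<in> W'" "norm z = 1" "\<And>x. x \<in> W' \<Longrightarrow> norm x = 1 \<Longrightarrow> norm (N x) \<le> norm (N z)"
      using attains[OF closedW'] by metis
    have "norm (N z) \<noteq> m"
    proof
      assume "norm (N z) = m"
      then have "z \<in> W" using z by (simp add: W_def)
      then have "z \<bullet> z = 0" using z(1) by (simp add: W'_def)
      then show False using z(2) by simp
    qed
    then have "norm (N z) < m" using m[of z] z(2) by simp
    then show thesis by (rule that[OF norm_ge_zero _ z(3)])
  qed
  have uW: "u \<in> W" using u(1) by (simp add: W_def m_def)
  show thesis
  proof (rule that[of P m' m u])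
    show "m \<le> c" using le[of u] u(1) by (simp add: m_def N_def)
    show "norm (A (P x) - P x) = m * norm (P x)" for x using P(2)[of x] by (simp add: W_def N_def)
    show "norm (A (x - P x) - (x - P x)) \<le> m' * norm (x - P x)" for x
      using scaled[OF W' subW' m'(3)] by (simp add: N_def)
    show "P u = u" using uW by (intro P_unique) auto
  qed (use P m' PA normP u in auto)
qed

section \<open>Isometries and their linear parts\<close>

definition lin :: "('a::real_normed_vector \<Rightarrow> 'a) \<Rightarrow> 'a \<Rightarrow> 'a" where
  "lin f x = f x - f 0"

context
  fixes f :: "'a::real_inner \<Rightarrow> 'a"
  assumes f: "f \<in> carrier isom_group"
begin

lemma isom_dist: "dist (f x) (f y) = dist x y"
  and isom_surj: "surj f"
  using f by (auto simp: isom_group_def)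

lemma orthogonal_lin: "orthogonal_transformation (lin f)"
  unfolding orthogonal_transformation_isometry
  using isom_dist by (simp add: lin_def dist_norm)

lemma linear_lin: "linear (lin f)"
  using orthogonal_lin by (rule orthogonal_transformation_linear)

lemma norm_lin: "norm (lin f x) = norm x"
  using orthogonal_lin by (rule orthogonal_transformation_norm)

lemma surj_lin: "surj (lin f)"
  unfolding surj_def
proof
  fix y
  obtain x where "y + f 0 = f x" using surjD[OF isom_surj, of "y + f 0"] by blast
  then have "y = lin f x" by (simp add: lin_def algebra_simps)
  then show "\<exists>x. y = lin f x" by blast
qed

lemma lin_add: "f (x + y) = f x + lin f y"
  using linear_add[OF linear_lin, of x y] by (simp add: lin_def algebra_simps)

lemma isom_affine: "f x = lin f x + f 0"
  by (simp add: lin_def)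

lemma lin_comp: "lin (f \<circ> g) x = lin f (lin g x)"
  using lin_add[of "g 0" "g x - g 0"] by (simp add: lin_def)

end

lemma translation_isom: "(\<lambda>x. x + t) \<in> carrier (isom_group :: ('a::real_inner \<Rightarrow> 'a) monoid)"
proof -
  have "surj (\<lambda>x. x + t)" by (rule surjI[of _ "\<lambda>x. x - t"]) simp
  then show ?thesis by (simp add: isom_group_def)
qed

section \<open>Crystallographic groups\<close>

text \<open>The reindexing by \<open>h\<close> is for conditions on
  \<open>f \<circ> \<gamma>\<close>, which appear when a neighbourhood is saturated by the right
  action of the lattice.\<close>

lemma open_fun_near:
  fixes h :: "'b \<Rightarrow> 'c" and g :: "'b \<Rightarrow> 'a::metric_space"
  assumes "finite F"
  shows "open {f :: 'c \<Rightarrow> 'a. \<forall>x\<in>F. dist (f (h x)) (g x) < \<epsilon>}"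
proof -
  have "open {f :: 'c \<Rightarrow> 'a. dist (f (h x)) (g x) < \<epsilon>}" for x
  proof -
    have "continuous_on UNIV (\<lambda>f :: 'c \<Rightarrow> 'a. dist (f (h x)) (g x))"
      by (intro continuous_on_dist continuous_on_const continuous_on_product_coordinates)
    then show ?thesis by (intro open_Collect_less continuous_on_const)
  qed
  moreover have "{f :: 'c \<Rightarrow> 'a. \<forall>x\<in>F. dist (f (h x)) (g x) < \<epsilon>}
      = (\<Inter>x\<in>F. {f. dist (f (h x)) (g x) < \<epsilon>})" by auto
  ultimately show ?thesis using assms by (simp add: open_INT)
qed

text \<open>Total boundedness of the orthogonal group as a finite colouring: \<open>c\<close>
  records the rounded images of the basis under the linear part. Equal colours leave an error of
  \<open>2 * \<eta>\<close> at each basis vector, whence the factor 2 in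
  \<open>\<eta>\<close>.\<close>

lemma (in orthonormal_basis) finite_lin_net:
  assumes "\<epsilon> > 0"
  obtains c :: "('a \<Rightarrow> 'a) \<Rightarrow> 'a \<Rightarrow> 'a" where "finite (c ` carrier isom_group)"
    "\<And>f g x. f \<in> carrier isom_group \<Longrightarrow> g \<in> carrier isom_group \<Longrightarrow> c f = c g \<Longrightarrow>
      norm (lin f x - lin g x) \<le> \<epsilon> * norm x"
proof -
  define \<eta> where "\<eta> = \<epsilon> / (2 * real (card E) + 1)"
  have \<eta>: "\<eta> > 0" using assms by (simp add: \<eta>_def add_nonneg_pos)
  have \<eta>_le: "real (card E) * (2 * \<eta>) \<le> \<epsilon>" using assms by (simp add: \<eta>_def field_simps)
  obtain d :: "'a \<Rightarrow> 'a" where d: "\<And>x. dist (d x) x < \<eta>" "\<And>R. finite (d ` cball 0 R)"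
    using finite_net[OF \<eta>] by metis
  define c where "c f = (\<lambda>e\<in>E. d (lin f e))" for f :: "'a \<Rightarrow> 'a"
  have "d (lin f e) \<in> d ` cball 0 1" if "f \<in> carrier isom_group" "e \<in> E" for f e
    using norm_lin[OF that(1)] unit_E[OF that(2)] by (intro imageI) simp
  then have "c ` carrier isom_group \<subseteq> (E \<rightarrow>\<^sub>E d ` cball 0 1)"
    by (auto simp: c_def)
  then have "finite (c ` carrier isom_group)"
    using finite_PiE[OF finite_E, of "\<lambda>_. d ` cball 0 1"] d(2) finite_subset by blast
  moreover have "norm (lin f x - lin g x) \<le> \<epsilon> * norm x"
    if fg: "f \<in> carrier isom_group" "g \<in> carrier isom_group" "c f = c g" for f g x
  proof -
    have "norm (lin f e - lin g e) \<le> 2 * \<eta>" if e: "e \<in> E" for e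
    proof -
      have "d (lin f e) = d (lin g e)" using fun_cong[OF fg(3), of e] e by (simp add: c_def)
      then have "dist (lin f e) (lin g e) < 2 * \<eta>"
        using dist_triangle2[of "lin f e" "lin g e" "d (lin f e)"] d(1)[of "lin f e"] d(1)[of "lin g e"]
        by (simp add: dist_commute)
      then show ?thesis by (simp add: dist_norm)
    qed
    then have "norm (lin f x - lin g x) \<le> real (card E) * (2 * \<eta>) * norm x"
      by (rule norm_linear_diff_le[OF linear_lin[OF fg(1)] linear_lin[OF fg(2)]])
    also have "\<dots> \<le> \<epsilon> * norm x" using \<eta>_le by (rule mult_right_mono) simp
    finally show ?thesis .
  qed
  ultimately show thesis by (rule that)
qed

section \<open>Consequences of discreteness\<close>

locale crystallographic = orthonormal_basis E for E :: "'a::real_inner set" +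
  fixes \<Gamma> :: "('a \<Rightarrow> 'a) set"
  assumes lattice: "lattice_in \<Gamma> isom_group"
begin

abbreviation G :: "('a \<Rightarrow> 'a) monoid" where "G \<equiv> isom_group"

lemma subgroup_\<Gamma>: "subgroup \<Gamma> G"
  using lattice by (simp add: lattice_in_def)

lemma mult_G: "f \<otimes>\<^bsub>G\<^esub> g = f \<circ> g" and one_G: "\<one>\<^bsub>G\<^esub> = id"
  by (simp_all add: isom_group_def)

lemma isom: "\<gamma> \<in> \<Gamma> \<Longrightarrow> \<gamma> \<in> carrier G"
  using subgroup.mem_carrier[OF subgroup_\<Gamma>] .

lemma comp_closed: "\<gamma> \<in> \<Gamma> \<Longrightarrow> \<delta> \<in> \<Gamma> \<Longrightarrow> \<gamma> \<circ> \<delta> \<in> \<Gamma>"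
  using subgroup.m_closed[OF subgroup_\<Gamma>] by (simp add: mult_G)

lemma id_closed: "id \<in> \<Gamma>"
  using subgroup.one_closed[OF subgroup_\<Gamma>] by (simp add: one_G)

lemma obtain_inverse:
  assumes "\<gamma> \<in> \<Gamma>"
  obtains \<delta> where "\<delta> \<in> \<Gamma>" "\<gamma> \<circ> \<delta> = id" "\<delta> \<circ> \<gamma> = id"
proof -
  interpret G: group G by (rule group_isom_group)
  have "\<gamma> \<otimes>\<^bsub>G\<^esub> inv\<^bsub>G\<^esub> \<gamma> = \<one>\<^bsub>G\<^esub>" "inv\<^bsub>G\<^esub> \<gamma> \<otimes>\<^bsub>G\<^esub> \<gamma> = \<one>\<^bsub>G\<^esub>"
    using isom[OF assms] by auto
  then show thesis
    using that[of "inv\<^bsub>G\<^esub> \<gamma>"] subgroup.m_inv_closed[OF subgroup_\<Gamma> assms] by (simp add: mult_G one_G)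
qed

text \<open>\<open>\<delta>\<close> is the inverse of \<open>\<gamma>\<close> followed by
  composition with \<open>\<gamma>'\<close>. Applying \<open>\<gamma>\<close> preserves lengths, so
  \<open>\<delta>\<close> is as far from the identity as \<open>\<gamma>'\<close> is from
  \<open>\<gamma>\<close>; isolation of the identity thus separates all elements uniformly.\<close>

lemma obtain_quotient:
  assumes "\<gamma> \<in> \<Gamma>" "\<gamma>' \<in> \<Gamma>"
  obtains \<delta> where "\<delta> \<in> \<Gamma>" "\<gamma> \<circ> \<delta> = \<gamma>'" "norm (\<delta> 0) = dist (\<gamma>' 0) (\<gamma> 0)"
    "\<And>x. norm (lin \<delta> x - x) = norm (lin \<gamma>' x - lin \<gamma> x)"
proof -
  obtain \<beta> where \<beta>: "\<beta> \<in> \<Gamma>" "\<gamma> \<circ> \<beta> = id" using obtain_inverse[OF assms(1)] by metis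
  let ?\<delta> = "\<beta> \<circ> \<gamma>'"
  note \<gamma> = isom[OF assms(1)]
  have \<delta>: "?\<delta> \<in> \<Gamma>" using \<beta> assms comp_closed by blast
  have eq: "\<gamma> \<circ> ?\<delta> = \<gamma>'" using \<beta>(2) by (simp add: o_assoc)
  have "norm (?\<delta> 0) = dist (\<gamma> (?\<delta> 0)) (\<gamma> 0)" using isom_dist[OF \<gamma>, of "?\<delta> 0" 0] by simp
  also have "\<gamma> (?\<delta> 0) = \<gamma>' 0" using fun_cong[OF eq, of 0] by simp
  finally have "norm (?\<delta> 0) = dist (\<gamma>' 0) (\<gamma> 0)" .
  moreover have "norm (lin ?\<delta> x - x) = norm (lin \<gamma>' x - lin \<gamma> x)" for x
  proof -
    have "norm (lin ?\<delta> x - x) = norm (lin \<gamma> (lin ?\<delta> x - x))" by (simp only: norm_lin[OF \<gamma>])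
    also have "lin \<gamma> (lin ?\<delta> x - x) = lin (\<gamma> \<circ> ?\<delta>) x - lin \<gamma> x"
      by (simp only: lin_comp[OF \<gamma>] linear_diff[OF linear_lin[OF \<gamma>]])
    finally show ?thesis unfolding eq .
  qed
  ultimately show thesis using that[OF \<delta> eq] by blast
qed

text \<open>A neighbourhood in the pointwise topology constrains values at a finite set
  \<open>F\<close> only. If \<open>\<rho>\<close> is the tolerance there and \<open>M\<close> bounds
  the norms of the points of \<open>F\<close>, then \<open>\<gamma>\<close> moves such a point by
  less than \<open>\<epsilon> + \<epsilon> * M\<close>; this dictates
  \<open>\<epsilon> = \<rho> / (M + 1)\<close>.\<close>

lemma isolated_id:
  obtains \<epsilon> where "\<epsilon> > 0"
    "\<And>\<gamma>. \<gamma> \<in> \<Gamma> \<Longrightarrow> norm (\<gamma> 0) < \<epsilon> \<Longrightarrow> (\<And>x. norm (lin \<gamma> x - x) \<le> \<epsilon> * norm x) \<Longrightarrow> \<gamma> = id"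
proof -
  have "discrete \<Gamma>" using lattice by (simp add: lattice_in_def)
  then obtain T where T: "open T" "T \<inter> \<Gamma> = {id}"
    using id_closed by (auto simp: discrete_def isolated_in_def)
  have idT: "id \<in> T" using T(2) by blast
  have "openin (product_topology (\<lambda>i. euclidean) UNIV) T" using T(1) by (simp add: open_fun_def)
  from product_topology_open_contains_basis[OF this idT]
  obtain X where X: "id \<in> (\<Pi>\<^sub>E i\<in>UNIV. X i)" "\<And>i. open (X i :: 'a set)"
    "finite {i. X i \<noteq> UNIV}" "(\<Pi>\<^sub>E i\<in>UNIV. X i) \<subseteq> T" by auto
  define F where "F = {i. X i \<noteq> UNIV}"
  have "\<exists>r>0. \<forall>y. dist y x < r \<longrightarrow> y \<in> X x" for x
    using X(1) X(2)[of x] by (auto simp: open_dist PiE_iff)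
  then obtain r where r: "\<And>x. r x > 0" "\<And>x y. dist y x < r x \<Longrightarrow> y \<in> X x" by metis
  define \<rho> where "\<rho> = Min (insert 1 (r ` F))"
  define M where "M = (\<Sum>x\<in>F. norm x)"
  have fin: "finite F" using X(3) by (simp add: F_def)
  have \<rho>: "\<rho> > 0" "\<And>x. x \<in> F \<Longrightarrow> \<rho> \<le> r x" using fin r(1) by (auto simp: \<rho>_def)
  have M: "M \<ge> 0" "\<And>x. x \<in> F \<Longrightarrow> norm x \<le> M"
    using fin by (auto simp: M_def sum_nonneg intro: member_le_sum)
  define \<epsilon> where "\<epsilon> = \<rho> / (M + 1)"
  have \<epsilon>: "\<epsilon> > 0" "\<epsilon> * (M + 1) = \<rho>" using \<rho> M by (auto simp: \<epsilon>_def)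
  show thesis
  proof (rule that[OF \<epsilon>(1)])
    fix \<gamma> assume \<gamma>: "\<gamma> \<in> \<Gamma>" "norm (\<gamma> 0) < \<epsilon>" "\<And>x. norm (lin \<gamma> x - x) \<le> \<epsilon> * norm x"
    have "\<gamma> x \<in> X x" for x
    proof (cases "x \<in> F")
      case True
      have eq: "\<gamma> x - x = \<gamma> 0 + (lin \<gamma> x - x)" by (simp add: lin_def)
      have "dist (\<gamma> x) x \<le> norm (\<gamma> 0) + norm (lin \<gamma> x - x)"
        unfolding dist_norm eq by (rule norm_triangle_ineq)
      also have "\<dots> < \<epsilon> + \<epsilon> * M"
        using \<gamma>(2) order_trans[OF \<gamma>(3) mult_left_mono[OF M(2)[OF True]]] \<epsilon>(1) by fastforce
      also have "\<dots> \<le> r x" using \<epsilon>(2) \<rho>(2)[OF True] by (simp add: algebra_simps)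
      finally show ?thesis by (rule r(2))
    next
      case False
      then show ?thesis by (simp add: F_def)
    qed
    then have "\<gamma> \<in> T" using X(4) by (auto simp: PiE_iff)
    then show "\<gamma> = id" using T(2) \<gamma>(1) by blast
  qed
qed

text \<open>Colour \<open>\<gamma>\<close> by its rounded linear part and the rounded point
  \<open>\<gamma> 0\<close>. Only finitely many colours occur, and the quotient of two elements of
  one colour is so close to the identity that it equals it.\<close>

lemma finite_bounded: "finite {\<gamma> \<in> \<Gamma>. norm (\<gamma> 0) \<le> R}"
proof -
  obtain \<epsilon> where \<epsilon>: "\<epsilon> > 0"
    "\<And>\<gamma>. \<gamma> \<in> \<Gamma> \<Longrightarrow> norm (\<gamma> 0) < \<epsilon> \<Longrightarrow> (\<And>x. norm (lin \<gamma> x - x) \<le> \<epsilon> * norm x) \<Longrightarrow> \<gamma> = id"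
    using isolated_id by metis
  obtain c :: "('a \<Rightarrow> 'a) \<Rightarrow> 'a \<Rightarrow> 'a" where c: "finite (c ` carrier G)"
    "\<And>f g x. f \<in> carrier G \<Longrightarrow> g \<in> carrier G \<Longrightarrow> c f = c g \<Longrightarrow> norm (lin f x - lin g x) \<le> \<epsilon> * norm x"
    using finite_lin_net[OF \<epsilon>(1)] by metis
  obtain d :: "'a \<Rightarrow> 'a" where d: "\<And>x. dist (d x) x < \<epsilon> / 2" "\<And>R. finite (d ` cball 0 R)"
    using finite_net[of "\<epsilon> / 2"] \<epsilon>(1) by auto
  let ?S = "{\<gamma> \<in> \<Gamma>. norm (\<gamma> 0) \<le> R}" and ?h = "\<lambda>\<gamma>. (c \<gamma>, d (\<gamma> 0))"
  have "?h ` ?S \<subseteq> c ` carrier G \<times> d ` cball 0 R" using isom by auto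
  then have "finite (?h ` ?S)" using c(1) d(2) by (meson finite_SigmaI finite_subset)
  moreover have "inj_on ?h ?S"
  proof (rule inj_onI)
    fix \<gamma> \<gamma>' assume "\<gamma> \<in> ?S" "\<gamma>' \<in> ?S" and eq: "?h \<gamma> = ?h \<gamma>'"
    then have \<gamma>: "\<gamma> \<in> \<Gamma>" "\<gamma>' \<in> \<Gamma>" by auto
    obtain \<delta> where \<delta>: "\<delta> \<in> \<Gamma>" "\<gamma> \<circ> \<delta> = \<gamma>'" "norm (\<delta> 0) = dist (\<gamma>' 0) (\<gamma> 0)"
      "\<And>x. norm (lin \<delta> x - x) = norm (lin \<gamma>' x - lin \<gamma> x)"
      using obtain_quotient[OF \<gamma>] by metis
    have "dist (\<gamma>' 0) (\<gamma> 0) < \<epsilon>"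
      using dist_triangle2[of "\<gamma>' 0" "\<gamma> 0" "d (\<gamma> 0)"] d(1)[of "\<gamma> 0"] d(1)[of "\<gamma>' 0"] eq
      by (simp add: dist_commute)
    moreover have "norm (lin \<delta> x - x) \<le> \<epsilon> * norm x" for x
      unfolding \<delta>(4) using c(2)[of \<gamma>' \<gamma>] isom \<gamma> eq by simp
    ultimately have "\<delta> = id" using \<epsilon>(2)[OF \<delta>(1)] \<delta>(3) by simp
    then show "\<gamma> = \<gamma>'" using \<delta>(2) by simp
  qed
  ultimately show ?thesis by (rule finite_imageD)
qed

lemma obtain_shortest:
  assumes "Z \<subseteq> \<Gamma>" "Z \<noteq> {}"
  obtains \<gamma> where "\<gamma> \<in> Z" "\<And>\<delta>. \<delta> \<in> Z \<Longrightarrow> norm (\<gamma> 0) \<le> norm (\<delta> 0)"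
proof -
  obtain \<zeta> where \<zeta>: "\<zeta> \<in> Z" using assms(2) by blast
  let ?S = "{\<gamma> \<in> Z. norm (\<gamma> 0) \<le> norm (\<zeta> 0)}"
  have "?S \<subseteq> {\<gamma> \<in> \<Gamma>. norm (\<gamma> 0) \<le> norm (\<zeta> 0)}" using assms(1) by blast
  then have fin: "finite ?S" using finite_bounded finite_subset by blast
  have "?S \<noteq> {}" using \<zeta> by blast
  then obtain \<gamma> where \<gamma>: "\<gamma> \<in> ?S" "\<And>\<delta>. \<delta> \<in> ?S \<Longrightarrow> norm (\<gamma> 0) \<le> norm (\<delta> 0)"
    using ex_is_arg_min_if_finite[OF fin, of "\<lambda>\<gamma>. norm (\<gamma> 0)"] by (force simp: is_arg_min_linorder)
  have "norm (\<gamma> 0) \<le> norm (\<delta> 0)" if "\<delta> \<in> Z" for \<delta>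
    using \<gamma> that by (cases "norm (\<delta> 0) \<le> norm (\<zeta> 0)") auto
  then show thesis using that \<gamma>(1) by blast
qed

text \<open>The cosets meeting \<open>{f. \<forall>x\<in>insert 0 E. dist (f x) (g x) < \<epsilon>}\<close> form a measurable set whose measure does not
  depend on \<open>g\<close>. Countably many of these sets cover the coset space, so their common measure is positive, and two of
  those that belong to the translations by \<open>0\<close>, \<open>v\<close>, \<open>2v\<close>, \<dots> must intersect.\<close>

lemma recurrence:
  fixes v :: 'a
  assumes "\<epsilon> > 0"
  obtains i j :: nat and f f' \<gamma> where "i < j" "f \<in> carrier G" "f' \<in> carrier G" "\<gamma> \<in> \<Gamma>" "f' = f \<circ> \<gamma>"
    "\<And>x. x \<in> insert 0 E \<Longrightarrow> dist (f x) (x + real i *\<^sub>R v) < \<epsilon>"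
    "\<And>x. x \<in> insert 0 E \<Longrightarrow> dist (f' x) (x + real j *\<^sub>R v) < \<epsilon>"
proof -
  interpret G: group G by (rule group_isom_group)
  obtain \<mu> where \<mu>: "finite_measure \<mu>" "sets \<mu> = sets (coset_space_borel G \<Gamma>)" "emeasure \<mu> (space \<mu>) \<noteq> 0"
    and inv: "\<And>g A. g \<in> carrier G \<Longrightarrow> A \<in> sets \<mu> \<Longrightarrow> emeasure \<mu> ((\<lambda>C. g <#\<^bsub>G\<^esub> C) ` A) = emeasure \<mu> A"
    using lattice unfolding lattice_in_def by blast
  interpret finite_measure \<mu> by (rule \<mu>(1))
  let ?F = "insert 0 E"
  have finF: "finite ?F" using finite_E by simp
  define B where "B g = {f \<in> carrier G. \<forall>x\<in>?F. dist (f x) (g x) < \<epsilon>}" for g :: "'a \<Rightarrow> 'a"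
  define C where "C g = (\<lambda>f. f <#\<^bsub>G\<^esub> \<Gamma>) ` B g" for g
  have lcos: "f <#\<^bsub>G\<^esub> \<Gamma> = {f \<circ> \<gamma> | \<gamma>. \<gamma> \<in> \<Gamma>}" for f
    by (auto simp: l_coset_def mult_G)
  have gens: "{U. U \<subseteq> lcosets\<^bsub>G\<^esub> \<Gamma> \<and> openin (top_of_set (carrier G)) (\<Union>U)} \<subseteq> Pow (lcosets\<^bsub>G\<^esub> \<Gamma>)" by blast
  have C_sub: "C g \<subseteq> lcosets\<^bsub>G\<^esub> \<Gamma>" for g by (auto simp: C_def B_def LCOSETS_def)
  \<comment> \<open>Moving the lattice element to the other side writes the saturation of
    \<open>B g\<close> as a union of open sets. This is the openness that makes \<open>C g\<close>
    measurable.\<close>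
  have Union_C: "\<Union>(C g) = carrier G \<inter> (\<Union>\<gamma>\<in>\<Gamma>. {f. \<forall>x\<in>?F. dist (f (\<gamma> x)) (g x) < \<epsilon>})" for g
  proof
    show "\<Union>(C g) \<subseteq> carrier G \<inter> (\<Union>\<gamma>\<in>\<Gamma>. {f. \<forall>x\<in>?F. dist (f (\<gamma> x)) (g x) < \<epsilon>})"
    proof
      fix h assume "h \<in> \<Union>(C g)"
      then obtain f \<gamma> where f: "f \<in> B g" "\<gamma> \<in> \<Gamma>" "h = f \<circ> \<gamma>" by (auto simp: C_def lcos)
      obtain \<delta> where \<delta>: "\<delta> \<in> \<Gamma>" "\<gamma> \<circ> \<delta> = id" using obtain_inverse[OF f(2)] by metis
      have "h (\<delta> x) = f x" for x using fun_cong[OF \<delta>(2), of x] f(3) by simp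
      then have "h \<in> {f. \<forall>x\<in>?F. dist (f (\<delta> x)) (g x) < \<epsilon>}" using f(1) by (simp add: B_def)
      moreover have "h \<in> carrier G"
        using G.m_closed[of f \<gamma>] f isom by (simp add: B_def mult_G)
      ultimately show "h \<in> carrier G \<inter> (\<Union>\<gamma>\<in>\<Gamma>. {f. \<forall>x\<in>?F. dist (f (\<gamma> x)) (g x) < \<epsilon>})" using \<delta>(1) by blast
    qed
    show "carrier G \<inter> (\<Union>\<gamma>\<in>\<Gamma>. {f. \<forall>x\<in>?F. dist (f (\<gamma> x)) (g x) < \<epsilon>}) \<subseteq> \<Union>(C g)"
    proof
      fix h assume "h \<in> carrier G \<inter> (\<Union>\<gamma>\<in>\<Gamma>. {f. \<forall>x\<in>?F. dist (f (\<gamma> x)) (g x) < \<epsilon>})"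
      then obtain \<gamma> where h: "h \<in> carrier G" "\<gamma> \<in> \<Gamma>" "\<forall>x\<in>?F. dist (h (\<gamma> x)) (g x) < \<epsilon>" by blast
      obtain \<delta> where \<delta>: "\<delta> \<in> \<Gamma>" "\<gamma> \<circ> \<delta> = id" using obtain_inverse[OF h(2)] by metis
      have "h \<circ> \<gamma> \<in> B g" using G.m_closed[of h \<gamma>] h isom by (simp add: B_def mult_G)
      moreover have "h = (h \<circ> \<gamma>) \<circ> \<delta>" using \<delta>(2) by (simp add: o_assoc[symmetric])
      ultimately show "h \<in> \<Union>(C g)" using \<delta>(1) unfolding C_def lcos by blast
    qed
  qed
  have opn: "open (\<Union>\<gamma>\<in>\<Gamma>. {f. \<forall>x\<in>?F. dist (f (\<gamma> x)) (g x) < \<epsilon>})" for g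
    by (intro open_UN ballI open_fun_near[OF finF])
  have "openin (top_of_set (carrier G)) (\<Union>(C g))" for g
    unfolding Union_C by (rule openin_open_Int[OF opn])
  then have "C g \<in> {U. U \<subseteq> lcosets\<^bsub>G\<^esub> \<Gamma> \<and> openin (top_of_set (carrier G)) (\<Union>U)}" for g
    using C_sub by simp
  then have C_sets: "C g \<in> sets \<mu>" for g
    unfolding \<mu>(2) coset_space_borel_def sets_measure_of[OF gens] by (rule sigma_sets.Basic)
  have space: "space \<mu> = lcosets\<^bsub>G\<^esub> \<Gamma>"
    using sets_eq_imp_space_eq[OF \<mu>(2)] by (simp add: coset_space_borel_def space_measure_of[OF gens])
  \<comment> \<open>Since \<open>g\<close> preserves distances, composing with it carries
    \<open>B id\<close> onto \<open>B g\<close>; invariance then gives all \<open>C g\<close> the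
    same measure.\<close>
  have C_translate: "C g = (\<lambda>D. g <#\<^bsub>G\<^esub> D) ` C id" if g: "g \<in> carrier G" for g
  proof -
    have coset: "g <#\<^bsub>G\<^esub> (f <#\<^bsub>G\<^esub> \<Gamma>) = (g \<circ> f) <#\<^bsub>G\<^esub> \<Gamma>" for f
      unfolding l_coset_def by (auto simp: mult_G o_assoc)
    have "B g = (\<lambda>f. g \<circ> f) ` B id"
    proof
      show "(\<lambda>f. g \<circ> f) ` B id \<subseteq> B g"
        using G.m_closed[OF g] isom_dist[OF g] by (auto simp: B_def mult_G)
      show "B g \<subseteq> (\<lambda>f. g \<circ> f) ` B id"
      proof
        fix f assume f: "f \<in> B g"
        let ?f = "inv\<^bsub>G\<^esub> g \<otimes>\<^bsub>G\<^esub> f"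
        have fG: "f \<in> carrier G" using f by (simp add: B_def)
        have eq: "g \<circ> ?f = f"
          using g fG G.m_assoc[of g "inv\<^bsub>G\<^esub> g" f] by (simp add: mult_G[symmetric])
        have "dist (?f x) x = dist (f x) (g x)" for x
          using isom_dist[OF g, of "?f x" x] fun_cong[OF eq, of x] by simp
        then have "\<forall>x\<in>?F. dist (?f x) (id x) < \<epsilon>" using f unfolding B_def mem_Collect_eq id_apply by presburger
        then have "?f \<in> B id" using g fG by (simp only: B_def mem_Collect_eq) simp
        then show "f \<in> (\<lambda>f. g \<circ> f) ` B id" using eq by (metis imageI)
      qed
    qed
    then show ?thesis by (simp add: C_def image_image coset)
  qed
  have C_measure: "emeasure \<mu> (C g) = emeasure \<mu> (C id)" if "g \<in> carrier G" for g
    using inv[OF that C_sets] C_translate[OF that] by simp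
  have C_pos: "emeasure \<mu> (C id) \<noteq> 0"
  proof
    assume zero: "emeasure \<mu> (C id) = 0"
    obtain d :: "'a \<Rightarrow> 'a" where d: "\<And>x. dist (d x) x < \<epsilon> / 2" "\<And>R. finite (d ` cball 0 R)"
      using finite_net[of "\<epsilon> / 2"] assms by auto
    have "range d = (\<Union>n::nat. d ` cball 0 (real n))"
    proof
      show "range d \<subseteq> (\<Union>n::nat. d ` cball 0 (real n))"
      proof
        fix y assume "y \<in> range d"
        then obtain x where x: "y = d x" by blast
        obtain n :: nat where "norm x \<le> real n" using real_arch_simple by blast
        then have "y \<in> d ` cball 0 (real n)" unfolding x by (intro imageI) simp
        then show "y \<in> (\<Union>n::nat. d ` cball 0 (real n))" by blast
      qed
    qed auto
    then have countable_d: "countable (range d)" using d(2) by (simp add: countable_finite)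
    \<comment> \<open>The label rounds the values of \<open>f\<close> on \<open>insert 0 E\<close>.
      It takes countably many values, and isometries with one label are within
      \<open>\<epsilon>\<close> at these points, so one representative per label suffices for the
      cover.\<close>
    define k where "k f = (\<lambda>x\<in>?F. d (f x))" for f :: "'a \<Rightarrow> 'a"
    have "k ` carrier G \<subseteq> (\<Pi>\<^sub>E x\<in>?F. range d)" by (rule image_subsetI) (simp only: k_def restrict_PiE_iff rangeI, blast)
    then have ctbl: "countable (k ` carrier G)"
      using countable_PiE[OF finF, of "\<lambda>_. range d"] countable_d countable_subset by blast
    define r where "r = inv_into (carrier G) k"
    have r: "r w \<in> carrier G" "k (r w) = w" if "w \<in> k ` carrier G" for w
      using that by (auto simp: r_def inv_into_into f_inv_into_f)
    have "space \<mu> \<subseteq> (\<Union>w\<in>k ` carrier G. C (r w))"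
    proof
      fix D assume "D \<in> space \<mu>"
      then obtain f where f: "f \<in> carrier G" "D = f <#\<^bsub>G\<^esub> \<Gamma>" by (auto simp: space LCOSETS_def)
      have "dist (f x) (r (k f) x) < \<epsilon>" if x: "x \<in> ?F" for x
      proof -
        have "d (f x) = d (r (k f) x)"
          using fun_cong[OF r(2)[of "k f"], of x] f(1) x by (simp add: k_def)
        then show ?thesis
          using dist_triangle2[of "f x" "r (k f) x" "d (f x)"] d(1)[of "f x"] d(1)[of "r (k f) x"]
          by (simp add: dist_commute)
      qed
      then have "f \<in> B (r (k f))" using f(1) by (simp add: B_def)
      then have "D \<in> C (r (k f))" using f(2) by (simp add: C_def)
      then show "D \<in> (\<Union>w\<in>k ` carrier G. C (r w))" using f(1) by blast
    qed
    moreover have "(\<Union>w\<in>k ` carrier G. C (r w)) \<in> null_sets \<mu>"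
      using ctbl C_measure r(1) zero C_sets by (intro null_sets_UN') (auto simp: null_sets_def)
    ultimately have "space \<mu> \<in> null_sets \<mu>" by (meson null_sets_subset sets.top)
    then show False using \<mu>(3) by auto
  qed
  define t where "t i = (\<lambda>x. x + real i *\<^sub>R v)" for i :: nat
  have t: "t i \<in> carrier G" for i unfolding t_def by (rule translation_isom)
  \<comment> \<open>The total measure is finite, so disjointness would make a constant series
    converge and force the common measure to be 0.\<close>
  have "\<not> disjoint_family (\<lambda>i. C (t i))"
  proof
    assume "disjoint_family (\<lambda>i. C (t i))"
    then have "(\<lambda>i. measure \<mu> (C (t i))) sums measure \<mu> (\<Union>i. C (t i))"
      using C_sets by (intro finite_measure_UNION) auto
    moreover have "measure \<mu> (C (t i)) = measure \<mu> (C id)" for i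
      using C_measure[OF t] by (simp add: measure_def)
    ultimately have "summable (\<lambda>i::nat. measure \<mu> (C id))" by (simp add: sums_iff)
    then have "measure \<mu> (C id) = 0" by (simp only: summable_const_iff)
    then show False using C_pos by (simp add: emeasure_eq_measure)
  qed
  then obtain i j where ij: "i < j" "C (t i) \<inter> C (t j) \<noteq> {}"
    unfolding disjoint_family_on_def by (metis Int_commute UNIV_I linorder_neqE_nat)
  then obtain f f' where f: "f \<in> B (t i)" "f' \<in> B (t j)" "f <#\<^bsub>G\<^esub> \<Gamma> = f' <#\<^bsub>G\<^esub> \<Gamma>"
    by (auto simp: C_def)
  have "f' \<in> f' <#\<^bsub>G\<^esub> \<Gamma>" unfolding lcos by (intro CollectI exI[of _ id]) (simp add: id_closed)
  then obtain \<gamma> where \<gamma>: "\<gamma> \<in> \<Gamma>" "f' = f \<circ> \<gamma>" using f(3) unfolding lcos by blast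
  show thesis
    by (rule that[OF ij(1) _ _ \<gamma>]) (use f in \<open>auto simp: B_def t_def\<close>)
qed

text \<open>Recurrence gives \<open>f' = f \<circ> \<gamma>\<close> with \<open>f\<close> near the
  translation by \<open>i\<close> times \<open>v\<close> and \<open>f'\<close> near that by
  \<open>j\<close> times \<open>v\<close>, so \<open>\<gamma>\<close> is nearly the translation by
  \<open>s = j - i\<close> times \<open>v\<close>. The linear part of \<open>f\<close> also distorts
  the vector \<open>s *\<^sub>R v\<close> by an amount that grows with \<open>s\<close>; hence the
  error is relative. The divisor \<open>4 * n + 4\<close> in \<open>\<eta>\<close> covers both the
  linear error \<open>4 * n * \<eta>\<close> and the displacement error
  \<open>(2 * \<eta> + 2 * n * \<eta>) * s\<close>.\<close>

lemma almost_translation_exists: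
  assumes v: "norm v = 1" and "\<epsilon> > 0"
  obtains \<gamma> s where "\<gamma> \<in> \<Gamma>" "s \<ge> 1" "norm (\<gamma> 0 - s *\<^sub>R v) \<le> \<epsilon> * s" "\<And>x. norm (lin \<gamma> x - x) \<le> \<epsilon> * norm x"
proof -
  define n where "n = real (card E)"
  define \<eta> where "\<eta> = \<epsilon> / (4 * n + 4)"
  have n: "n \<ge> 0" by (simp add: n_def)
  have "\<eta> * (4 * n + 4) = \<epsilon>" using n by (simp add: \<eta>_def)
  then have "\<epsilon> = 4 * (n * \<eta>) + 4 * \<eta>" by (simp add: algebra_simps)
  moreover have "\<eta> > 0" "n * \<eta> \<ge> 0" using assms(2) n by (simp_all add: \<eta>_def)
  ultimately have \<eta>: "\<eta> > 0" "4 * n * \<eta> \<le> \<epsilon>" "2 * \<eta> + 2 * n * \<eta> \<le> \<epsilon>"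
    by linarith+
  obtain i j :: nat and f f' \<gamma> where ij: "i < j" and fG: "f \<in> carrier G" "f' \<in> carrier G"
    and \<gamma>: "\<gamma> \<in> \<Gamma>" "f' = f \<circ> \<gamma>"
    and f: "\<And>x. x \<in> insert 0 E \<Longrightarrow> dist (f x) (x + real i *\<^sub>R v) < \<eta>"
    and f': "\<And>x. x \<in> insert 0 E \<Longrightarrow> dist (f' x) (x + real j *\<^sub>R v) < \<eta>"
    using recurrence[OF \<eta>(1), of v] by metis
  \<comment> \<open>The linear part is read off from \<open>g e - g 0\<close>, where the translation
    \<open>w\<close> cancels and two errors below \<open>\<eta>\<close> remain.\<close>
  have near: "norm (lin g x - x) \<le> 2 * n * \<eta> * norm x"
    if g: "g \<in> carrier G" "\<And>x. x \<in> insert 0 E \<Longrightarrow> dist (g x) (x + w) < \<eta>" for g w x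
  proof -
    have "norm (lin g e - e) \<le> 2 * \<eta>" if e: "e \<in> E" for e
    proof -
      have "lin g e - e = (g e - (e + w)) - (g 0 - w)" by (simp add: lin_def)
      then have "norm (lin g e - e) \<le> norm (g e - (e + w)) + norm (g 0 - w)"
        by (metis norm_triangle_ineq4)
      then show ?thesis using g(2)[of e] g(2)[of 0] e by (simp add: dist_norm)
    qed
    then have "norm (lin g x - x) \<le> real (card E) * (2 * \<eta>) * norm x"
      using norm_linear_diff_le[OF linear_lin[OF g(1)] linear_ident] by blast
    then show ?thesis by (simp add: n_def mult_ac)
  qed
  define s where "s = real j - real i"
  have s: "s \<ge> 1" using ij by (simp add: s_def)
  have "norm (lin \<gamma> x - x) \<le> \<epsilon> * norm x" for x
  proof -
    have "norm (lin \<gamma> x - x) = norm (lin f (lin \<gamma> x - x))" by (simp add: norm_lin[OF fG(1)])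
    also have "lin f (lin \<gamma> x - x) = (lin f' x - x) - (lin f x - x)"
      by (simp add: \<gamma>(2) lin_comp[OF fG(1)] linear_diff[OF linear_lin[OF fG(1)]])
    also have "norm \<dots> \<le> norm (lin f' x - x) + norm (lin f x - x)" by (rule norm_triangle_ineq4)
    also have "\<dots> \<le> 2 * n * \<eta> * norm x + 2 * n * \<eta> * norm x"
      using near[OF fG(2) f'] near[OF fG(1) f] by (intro add_mono) auto
    also have "\<dots> = 4 * n * \<eta> * norm x" by simp
    also have "\<dots> \<le> \<epsilon> * norm x" using \<eta>(2) by (rule mult_right_mono) simp
    finally show ?thesis .
  qed
  moreover have "norm (\<gamma> 0 - s *\<^sub>R v) \<le> \<epsilon> * s"
  proof -
    have "norm (\<gamma> 0 - s *\<^sub>R v) = norm (lin f (\<gamma> 0 - s *\<^sub>R v))" by (simp add: norm_lin[OF fG(1)])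
    also have "lin f (\<gamma> 0 - s *\<^sub>R v) = (f' 0 - real j *\<^sub>R v) - (f 0 - real i *\<^sub>R v) - (lin f (s *\<^sub>R v) - s *\<^sub>R v)"
      by (simp add: \<gamma>(2) linear_diff[OF linear_lin[OF fG(1)]]) (simp add: lin_def s_def scaleR_diff_left)
    also have "norm \<dots> \<le> norm (f' 0 - real j *\<^sub>R v) + norm (f 0 - real i *\<^sub>R v) + norm (lin f (s *\<^sub>R v) - s *\<^sub>R v)"
      by (intro order_trans[OF norm_triangle_ineq4] add_mono norm_triangle_ineq4 order_refl)
    also have "\<dots> \<le> \<eta> + \<eta> + 2 * n * \<eta> * s"
      using f[of 0] f'[of 0] near[OF fG(1) f, of "s *\<^sub>R v"] v s
      by (intro add_mono) (auto simp: dist_norm)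
    also have "\<dots> \<le> (2 * \<eta> + 2 * n * \<eta>) * s"
      using \<eta>(1) s by (simp add: algebra_simps)
    also have "\<dots> \<le> \<epsilon> * s" using \<eta>(3) s by (intro mult_right_mono) auto
    finally show ?thesis .
  qed
  ultimately show thesis using that \<gamma>(1) s by blast
qed

text \<open>Buser's argument: take \<open>\<alpha>\<close> violating the claim with shortest translation part \<open>a\<close>, let \<open>P\<close> be the projection
  onto the subspace on which \<open>A - id\<close> expands most, where \<open>A = lin \<alpha>\<close>, and take \<open>\<beta>\<close> with shortest nonzero translation
  part \<open>b\<close> among the elements with \<open>lin \<beta>\<close> close to \<open>id\<close> and \<open>b\<close> close to the range of \<open>P\<close>. The
  commutator of \<open>\<alpha>\<close> and \<open>\<beta>\<close> has translation part close to \<open>A b - b\<close>; it is again of this kind, but shorter than \<open>\<beta>\<close>.\<close>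

lemma lin_eq_id_if_near:
  assumes "\<alpha> \<in> \<Gamma>" "\<And>x. norm (lin \<alpha> x - x) \<le> 1/2 * norm x"
  shows "lin \<alpha> = id"
proof (rule ccontr)
  assume neq: "lin \<alpha> \<noteq> id"
  define X where "X = {\<alpha> \<in> \<Gamma>. lin \<alpha> \<noteq> id \<and> (\<forall>x. norm (lin \<alpha> x - x) \<le> 1/2 * norm x)}"
  have "X \<subseteq> \<Gamma>" "X \<noteq> {}" using assms neq by (auto simp: X_def)
  then obtain \<alpha> where "\<alpha> \<in> X" and \<alpha>_min: "\<And>\<beta>. \<beta> \<in> X \<Longrightarrow> norm (\<alpha> 0) \<le> norm (\<beta> 0)"
    using obtain_shortest by blast
  then have \<alpha>: "\<alpha> \<in> \<Gamma>" "lin \<alpha> \<noteq> id" and A_le: "\<And>x. norm (lin \<alpha> x - x) \<le> 1/2 * norm x"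
    by (auto simp: X_def)
  note \<alpha>G = isom[OF \<alpha>(1)]
  define A a where "A = lin \<alpha>" and "a = \<alpha> 0"
  note A_le = A_le[folded A_def]
  have linA: "linear A" unfolding A_def by (rule linear_lin[OF \<alpha>G])
  obtain m m' P u where P: "linear P" and m: "0 \<le> m'" "m' < m" "m \<le> 1/2"
    and PA: "\<And>x. P (A x) = A (P x)" and normP: "\<And>x. norm (P x) \<le> norm x" "\<And>x. norm (x - P x) \<le> norm x"
    and AP: "\<And>x. norm (A (P x) - P x) = m * norm (P x)"
    and AQ: "\<And>x. norm (A (x - P x) - (x - P x)) \<le> m' * norm (x - P x)"
    and u: "norm u = 1" "P u = u"
    by (rule max_eigenspace_gap[OF orthogonal_lin[OF \<alpha>G] surj_lin[OF \<alpha>G] \<alpha>(2) A_le[unfolded A_def],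
          folded A_def]) (rule that)
  \<comment> \<open>The gap \<open>16 * \<delta>\<close> must exceed two losses of
    \<open>6 * \<delta>\<close> below. From \<open>m \<le> 1/2\<close> follows
    \<open>\<delta> \<le> 1/32\<close>, which makes the commutator shorter at the end.\<close>
  define \<delta> where "\<delta> = (m - m') / 16"
  have \<delta>: "\<delta> > 0" "\<delta> \<le> 1/32" "m - m' = 16 * \<delta>" using m by (auto simp: \<delta>_def)
  define Y where "Y = {\<beta> \<in> \<Gamma>. \<beta> 0 \<noteq> 0 \<and> (\<forall>x. norm (lin \<beta> x - x) \<le> \<delta> * norm x)
    \<and> norm (\<beta> 0 - P (\<beta> 0)) \<le> norm (P (\<beta> 0))}"
  have "Y \<noteq> {}"
  proof -
    \<comment> \<open>\<open>P\<close> fixes the direction \<open>u\<close>, and the error is at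
      most half of \<open>s\<close>. So the component of \<open>\<beta> 0\<close> in the range of
      \<open>P\<close> has length at least \<open>s / 2\<close>, the other one at most
      \<open>s / 2\<close>.\<close>
    obtain \<beta> s where \<beta>: "\<beta> \<in> \<Gamma>" "s \<ge> 1" "norm (\<beta> 0 - s *\<^sub>R u) \<le> \<delta> * s"
      "\<And>x. norm (lin \<beta> x - x) \<le> \<delta> * norm x"
      using almost_translation_exists[OF u(1) \<delta>(1)] by metis
    let ?d = "\<beta> 0 - s *\<^sub>R u"
    have Pd: "P ?d = P (\<beta> 0) - s *\<^sub>R u" using P u(2) by (simp add: linear_diff linear_scale)
    have half: "\<delta> * s \<le> s / 2" using \<delta>(2) \<beta>(2) mult_right_mono[of \<delta> "1/2" s] by simp
    have eq: "\<beta> 0 - P (\<beta> 0) = ?d - P ?d" unfolding Pd by simp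
    have q: "norm (\<beta> 0 - P (\<beta> 0)) \<le> s / 2"
      unfolding eq using normP(2)[of ?d] \<beta>(3) half by linarith
    have "s = norm (P (\<beta> 0) - P ?d)" unfolding Pd using u(1) \<beta>(2) by simp
    also have "\<dots> \<le> norm (P (\<beta> 0)) + norm (P ?d)" by (rule norm_triangle_ineq4)
    finally have p: "s / 2 \<le> norm (P (\<beta> 0))" using normP(1)[of ?d] \<beta>(3) half by linarith
    then have "\<beta> 0 \<noteq> 0" using \<beta>(2) normP(1)[of "\<beta> 0"] by auto
    then show ?thesis using \<beta>(1,4) p q unfolding Y_def by force
  qed
  moreover have "Y \<subseteq> \<Gamma>" by (auto simp: Y_def)
  ultimately obtain \<beta> where "\<beta> \<in> Y" and \<beta>_min: "\<And>\<kappa>. \<kappa> \<in> Y \<Longrightarrow> norm (\<beta> 0) \<le> norm (\<kappa> 0)"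
    using obtain_shortest by blast
  then have \<beta>: "\<beta> \<in> \<Gamma>" and b0: "\<beta> 0 \<noteq> 0" and B_le: "\<And>x. norm (lin \<beta> x - x) \<le> \<delta> * norm x"
    and Qb: "norm (\<beta> 0 - P (\<beta> 0)) \<le> norm (P (\<beta> 0))"
    by (auto simp: Y_def)
  note \<beta>G = isom[OF \<beta>]
  define B b where "B = lin \<beta>" and "b = \<beta> 0"
  note b0 = b0[folded b_def] and B_le = B_le[folded B_def] and Qb = Qb[folded b_def]
  have linB: "linear B" unfolding B_def by (rule linear_lin[OF \<beta>G])
  \<comment> \<open>If \<open>B\<close> is nontrivial, \<open>\<beta>\<close> itself competes with
    \<open>\<alpha>\<close> in \<open>X\<close>, so minimality of \<open>\<alpha>\<close> bounds
    \<open>a\<close>. If \<open>B = id\<close>, no bound on \<open>a\<close> is required, because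
    the error \<open>r\<close> vanishes.\<close>
  have short: "B = id \<or> norm a \<le> norm b"
  proof (rule disjCI)
    assume "\<not> norm a \<le> norm b"
    then have "\<beta> \<notin> X" using \<alpha>_min unfolding a_def b_def by blast
    moreover have "norm (lin \<beta> x - x) \<le> 1/2 * norm x" for x
      using B_le[of x] \<delta>(2) mult_right_mono[of \<delta> "1/2" "norm x"] unfolding B_def by simp
    ultimately show "B = id" using \<beta> unfolding X_def B_def by blast
  qed
  \<comment> \<open>The commutator of \<open>A\<close> and \<open>B\<close> as linear maps is that
    of \<open>A - id\<close> and \<open>B - id\<close>, so its norm is at most twice the product of
    1/2 and \<open>\<delta>\<close>.\<close>
  have commute: "norm (A (B x) - B (A x)) \<le> \<delta> * norm x" for x
  proof -
    have "A (B x) - B (A x) = (A (B x - x) - (B x - x)) - (B (A x - x) - (A x - x))"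
      using linA linB by (simp add: linear_diff)
    also have "norm \<dots> \<le> norm (A (B x - x) - (B x - x)) + norm (B (A x - x) - (A x - x))"
      by (rule norm_triangle_ineq4)
    also have "\<dots> \<le> 1/2 * norm (B x - x) + \<delta> * norm (A x - x)" using A_le B_le by (intro add_mono)
    also have "\<dots> \<le> 1/2 * (\<delta> * norm x) + \<delta> * (1/2 * norm x)"
      using A_le B_le \<delta>(1) by (intro add_mono mult_left_mono) auto
    finally show ?thesis by simp
  qed
  have \<beta>\<alpha>: "\<beta> \<circ> \<alpha> \<in> \<Gamma>" using \<alpha>(1) \<beta> comp_closed by blast
  obtain \<omega> where \<omega>: "\<omega> \<in> \<Gamma>" "(\<beta> \<circ> \<alpha>) \<circ> \<omega> = id" using obtain_inverse[OF \<beta>\<alpha>] by metis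
  \<comment> \<open>This is the group commutator: \<open>\<omega>\<close> is the inverse of
    \<open>\<beta> \<circ> \<alpha>\<close>.\<close>
  define \<kappa> where "\<kappa> = (\<alpha> \<circ> \<beta>) \<circ> \<omega>"
  have \<alpha>\<beta>: "\<alpha> \<circ> \<beta> \<in> \<Gamma>" using \<alpha>(1) \<beta> comp_closed by blast
  have \<kappa>: "\<kappa> \<in> \<Gamma>" unfolding \<kappa>_def using \<alpha>\<beta> \<omega>(1) comp_closed by blast
  have lin_\<kappa>: "norm (lin \<kappa> z - z) \<le> \<delta> * norm z" for z
  proof -
    define w where "w = lin \<omega> z"
    have "lin ((\<beta> \<circ> \<alpha>) \<circ> \<omega>) z = z" unfolding \<omega>(2) by (simp add: lin_def)
    then have "z = B (A w)"
      by (simp only: lin_comp[OF isom[OF \<beta>\<alpha>]] lin_comp[OF \<beta>G] w_def A_def B_def)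
    moreover have "lin \<kappa> z = A (B w)"
      by (simp only: \<kappa>_def lin_comp[OF isom[OF \<alpha>\<beta>]] lin_comp[OF \<alpha>G] w_def A_def B_def)
    moreover have "norm w = norm z" unfolding w_def by (rule norm_lin[OF isom[OF \<omega>(1)]])
    ultimately show ?thesis using commute[of w] by simp
  qed
  define x where "x = \<omega> 0"
  define y where "y = \<kappa> 0"
  have zero: "B (A x) + B a + b = 0"
  proof -
    have "0 = \<beta> (\<alpha> x)" using fun_cong[OF \<omega>(2), of 0] by (simp add: x_def)
    also have "\<dots> = B (\<alpha> x) + b" unfolding B_def b_def by (rule isom_affine[OF \<beta>G])
    also have "\<alpha> x = A x + a" unfolding A_def a_def by (rule isom_affine[OF \<alpha>G])
    finally show ?thesis by (simp add: linear_add[OF linB])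
  qed
  have y_eq: "y = A (B x) + A b + a"
  proof -
    have "y = \<alpha> (\<beta> x)" by (simp add: y_def \<kappa>_def x_def)
    also have "\<dots> = A (\<beta> x) + a" unfolding A_def a_def by (rule isom_affine[OF \<alpha>G])
    also have "\<beta> x = B x + b" unfolding B_def b_def by (rule isom_affine[OF \<beta>G])
    finally show ?thesis by (simp add: linear_add[OF linA])
  qed
  have norm_x: "norm x \<le> norm a + norm b"
  proof -
    have "norm x = norm (B (A x))" unfolding A_def B_def by (simp add: norm_lin[OF \<alpha>G] norm_lin[OF \<beta>G])
    also have "B (A x) = - (B a + b)" using zero by (metis add.assoc eq_neg_iff_add_eq_0)
    also have "norm \<dots> \<le> norm (B a) + norm b" unfolding norm_minus_cancel by (rule norm_triangle_ineq)
    finally show ?thesis unfolding B_def by (simp add: norm_lin[OF \<beta>G])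
  qed
  \<comment> \<open>The error of \<open>A b - b\<close> as translation part of the commutator. For
    nontrivial \<open>B\<close> it is at most \<open>3 * \<delta> * norm b\<close>: two parts come
    from \<open>norm x \<le> norm a + norm b\<close>, one from \<open>B a - a\<close>.\<close>
  define r where "r = y - (A b - b)"
  have r_eq: "r = (A (B x) - B (A x)) - (B a - a)"
    using zero unfolding r_def y_eq by (simp add: algebra_simps)
  have r_le: "norm r \<le> 3 * \<delta> * norm b"
  proof (cases "B = id")
    case True
    then have "r = 0" unfolding r_eq by simp
    then show ?thesis using \<delta>(1) by simp
  next
    case False
    then have ab: "norm a \<le> norm b" using short by blast
    have "norm r \<le> norm (A (B x) - B (A x)) + norm (B a - a)" unfolding r_eq by (rule norm_triangle_ineq4)
    also have "\<dots> \<le> \<delta> * (norm b + norm b) + \<delta> * norm b"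
      using order_trans[OF commute[of x] mult_left_mono[of "norm x" "norm b + norm b" \<delta>]]
        order_trans[OF B_le[of a] mult_left_mono[OF ab, of \<delta>]] norm_x ab \<delta>(1) by (intro add_mono) auto
    finally show ?thesis by (simp add: algebra_simps)
  qed
  let ?p = "norm (P b)"
  have "norm b \<le> ?p + norm (b - P b)" using norm_triangle_ineq[of "P b" "b - P b"] by simp
  then have b_le: "norm b \<le> 2 * ?p" using Qb by simp
  then have p0: "?p > 0" using b0 by (metis norm_eq_zero norm_ge_zero not_le mult_zero_right order_le_less zero_less_norm_iff)
  have "3 * \<delta> * norm b \<le> 3 * \<delta> * (2 * ?p)" using b_le \<delta>(1) by (intro mult_left_mono) auto
  then have r_le': "norm r \<le> 6 * \<delta> * ?p" using r_le by simp
  have y_r: "y = (A b - b) + r" by (simp add: r_def)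
  have P_y: "P y = (A (P b) - P b) + P r"
    unfolding y_r by (simp add: linear_add[OF P] linear_diff[OF P] PA)
  have Py: "m * ?p - 6 * \<delta> * ?p \<le> norm (P y)"
  proof -
    have "norm (A (P b) - P b) \<le> norm (P y) + norm (P r)"
      using P_y by (metis add_diff_cancel_right' norm_triangle_ineq4)
    then show ?thesis using normP(1)[of r] r_le' unfolding AP by linarith
  qed
  have Qy: "norm (y - P y) \<le> m' * ?p + 6 * \<delta> * ?p"
  proof -
    have "y - P y = (A (b - P b) - (b - P b)) + (r - P r)"
      unfolding P_y by (simp add: linear_diff[OF linA]) (simp add: y_r)
    then have "norm (y - P y) \<le> norm (A (b - P b) - (b - P b)) + norm (r - P r)"
      by (metis norm_triangle_ineq)
    also have "\<dots> \<le> m' * norm (b - P b) + norm r" using AQ normP(2) by (intro add_mono) auto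
    also have "\<dots> \<le> m' * ?p + 6 * \<delta> * ?p" using Qb m(1) r_le' by (intro add_mono mult_left_mono) auto
    finally show ?thesis .
  qed
  \<comment> \<open>Both components of \<open>y\<close> lose at most
    \<open>6 * \<delta> * ?p\<close>, where 6 is 3 from the bound on \<open>r\<close> times 2 from
    \<open>norm b \<le> 2 * ?p\<close>. The gap outweighs this, so \<open>y\<close> is nonzero and
    satisfies the cone condition of \<open>Y\<close>.\<close>
  have "m * ?p = m' * ?p + 16 * \<delta> * ?p" using \<delta>(3) by (simp flip: distrib_right)
  moreover have "\<delta> * ?p > 0" using \<delta>(1) p0 by simp
  ultimately have gap: "norm (y - P y) < norm (P y)" using Py Qy by linarith
  have "y \<noteq> 0"
  proof
    assume "y = 0"
    then show False using gap linear_0[OF P] by simp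
  qed
  then have "\<kappa> \<in> Y" using \<kappa> lin_\<kappa> gap unfolding Y_def y_def by (simp add: less_imp_le)
  then have "norm b \<le> norm y" using \<beta>_min unfolding b_def y_def by blast
  moreover have "norm y \<le> norm (A b - b) + norm r"
    using norm_triangle_ineq[of "A b - b" r] by (simp add: r_def)
  \<comment> \<open>The total factor 1/2 + 3/32 is below 1, against the minimality of
    \<open>\<beta>\<close>.\<close>
  moreover have "3 * \<delta> * norm b \<le> 3 * (1/32) * norm b" using \<delta>(2) by (intro mult_right_mono) auto
  moreover have "norm b > 0" using b0 by simp
  ultimately show False using A_le[of b] r_le by linarith
qed

end

section \<open>Discrete subgroups of a vector space\<close>

definition int_combinations :: "'a::real_vector set \<Rightarrow> 'a set" where
  "int_combinations B = {\<Sum>b\<in>B. of_int (k b) *\<^sub>R b | k. True}"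

lemma int_combinationsI: "(\<Sum>b\<in>B. of_int (k b) *\<^sub>R b) \<in> int_combinations B"
  unfolding int_combinations_def by blast

definition translation :: "'a::real_inner \<Rightarrow> 'a \<Rightarrow> 'a" where
  "translation t = (\<lambda>x. x + t)"

lemma translation_comp: "translation s \<circ> translation t = translation (s + t)"
  by (auto simp: translation_def)

lemma translation_eq_iff [simp]: "translation s = translation t \<longleftrightarrow> s = t"
  by (auto simp: translation_def fun_eq_iff)

lemma translation_0: "translation 0 = id"
  by (auto simp: translation_def)

locale additive_subgroup =
  fixes T :: "'a::real_vector set"
  assumes zero: "0 \<in> T" and diff: "\<And>s t. s \<in> T \<Longrightarrow> t \<in> T \<Longrightarrow> s - t \<in> T"
begin

lemma minus: "t \<in> T \<Longrightarrow> - t \<in> T"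
  using diff[OF zero] by simp

lemma add: "s \<in> T \<Longrightarrow> t \<in> T \<Longrightarrow> s + t \<in> T"
  using diff[OF _ minus] by simp

lemma scale_nat: "t \<in> T \<Longrightarrow> real n *\<^sub>R t \<in> T"
  by (induction n) (auto simp: zero scaleR_add_left intro: add)

lemma scale_int: "t \<in> T \<Longrightarrow> of_int n *\<^sub>R t \<in> T"
proof (cases "n \<ge> 0")
  case True
  assume "t \<in> T"
  then show ?thesis using scale_nat[of t "nat n"] True by simp
next
  case False
  assume "t \<in> T"
  then show ?thesis using minus[OF scale_nat[of t "nat (- n)"]] False by simp
qed

lemma sum_int: "B \<subseteq> T \<Longrightarrow> (\<Sum>b\<in>B. of_int (k b) *\<^sub>R b) \<in> T"
  by (induction B rule: infinite_finite_induct) (auto intro: zero add scale_int)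

end

locale discrete_subgroup = additive_subgroup T for T :: "'a::real_normed_vector set" +
  assumes finite_bounded_part: "\<And>R. finite {t \<in> T. norm t \<le> R}"
begin

text \<open>The last basis vector is a lattice vector whose component outside \<open>span D\<close> is positive and minimal. Reducing
  modulo the lattice in \<open>span D\<close> bounds the candidates, so the minimum exists.\<close>

lemma int_basis_of_span:
  assumes "finite D" "independent D" "D \<subseteq> T"
  shows "\<exists>B. finite B \<and> independent B \<and> B \<subseteq> T \<and> span B = span D \<and> T \<inter> span D = int_combinations B"
  using assms
proof (induction D rule: finite_induct)
  case empty
  then show ?case using zero by (intro exI[of _ "{}"]) (auto simp: int_combinations_def)
next
  case (insert d D)
  then have indep: "independent D" "d \<notin> span D" "d \<in> T"
    by (auto simp: independent_insert)
  obtain B where B: "finite B" "independent B" "B \<subseteq> T" "span B = span D" "T \<inter> span D = int_combinations B"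
    using insert indep by auto
  define M where "M = (\<Sum>b\<in>B. norm b)"
  have reduce: "\<exists>y\<in>T. y - r *\<^sub>R d \<in> span D \<and> norm y \<le> \<bar>r\<bar> * norm d + M"
    if x: "x \<in> T" "x - r *\<^sub>R d \<in> span D" for x r
  proof -
    have "x - r *\<^sub>R d \<in> span B" using x B(4) by simp
    then obtain c where c: "x - r *\<^sub>R d = (\<Sum>b\<in>B. c b *\<^sub>R b)" unfolding span_finite[OF B(1)] by auto
    define w where "w = (\<Sum>b\<in>B. of_int \<lfloor>c b\<rfloor> *\<^sub>R b)"
    have w: "w \<in> T" "w \<in> span D"
      using sum_int[OF B(3)] B(4) by (auto simp: w_def intro!: span_sum span_scale intro: span_base)
    have frac: "x - w = r *\<^sub>R d + (\<Sum>b\<in>B. frac (c b) *\<^sub>R b)"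
      using c by (simp add: w_def frac_def scaleR_diff_left sum_subtractf algebra_simps)
    have "norm (frac (c b) *\<^sub>R b) \<le> norm b" for b
      using frac_ge_0[of "c b"] frac_lt_1[of "c b"] mult_right_mono[of "frac (c b)" 1 "norm b"] by simp
    then have "norm (\<Sum>b\<in>B. frac (c b) *\<^sub>R b) \<le> M" unfolding M_def by (rule sum_norm_le)
    then have "norm (x - w) \<le> \<bar>r\<bar> * norm d + M"
      unfolding frac using norm_triangle_ineq[of "r *\<^sub>R d" "\<Sum>b\<in>B. frac (c b) *\<^sub>R b"] by simp
    moreover have "(x - w) - r *\<^sub>R d \<in> span D"
      using span_diff[OF x(2) w(2)] by (simp add: algebra_simps)
    ultimately show ?thesis using diff[OF x(1) w(1)] by blast
  qed
  have coeff_unique: "r = s" if "x - r *\<^sub>R d \<in> span D" "x - s *\<^sub>R d \<in> span D" for x r s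
  proof (rule ccontr)
    assume "r \<noteq> s"
    have "(s - r) *\<^sub>R d \<in> span D"
      using span_diff[OF that] by (simp add: algebra_simps)
    then have "(1 / (s - r)) *\<^sub>R ((s - r) *\<^sub>R d) \<in> span D" by (rule span_scale)
    then show False using \<open>r \<noteq> s\<close> indep(2) by simp
  qed
  \<comment> \<open>The cutoff at 1 is harmless because \<open>d\<close> has coordinate 1, and it
    keeps the reduced representatives in a fixed ball.\<close>
  define S where "S = {r. 0 < r \<and> r \<le> 1 \<and> (\<exists>x\<in>T. x - r *\<^sub>R d \<in> span D)}"
  have "finite S"
  proof -
    define h where "h x = (THE r. x - r *\<^sub>R d \<in> span D)" for x
    have h: "h x = r" if "x - r *\<^sub>R d \<in> span D" for x r
      unfolding h_def using that coeff_unique by (intro the_equality) auto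
    have "S \<subseteq> h ` {t \<in> T. norm t \<le> norm d + M}"
    proof
      fix r assume "r \<in> S"
      then obtain x where x: "0 < r" "r \<le> 1" "x \<in> T" "x - r *\<^sub>R d \<in> span D" by (auto simp: S_def)
      obtain y where y: "y \<in> T" "y - r *\<^sub>R d \<in> span D" "norm y \<le> \<bar>r\<bar> * norm d + M"
        using reduce[OF x(3,4)] by blast
      have "\<bar>r\<bar> * norm d \<le> norm d" using x mult_right_mono[of r 1 "norm d"] by simp
      then have "norm y \<le> norm d + M" using y(3) by simp
      then show "r \<in> h ` {t \<in> T. norm t \<le> norm d + M}"
        using y h[OF y(2)] by (intro image_eqI[of _ _ y]) auto
    qed
    then show ?thesis using finite_bounded_part finite_surj by blast
  qed
  moreover have "1 \<in> S" using indep(3) span_zero[of D] by (auto simp: S_def intro!: bexI[of _ d])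
  ultimately have "Min S \<in> S" and Min_le: "\<And>r. r \<in> S \<Longrightarrow> Min S \<le> r" by (auto intro: Min_in)
  define r0 where "r0 = Min S"
  obtain x0 where x0: "0 < r0" "r0 \<le> 1" "x0 \<in> T" "x0 - r0 *\<^sub>R d \<in> span D"
    using \<open>Min S \<in> S\<close> by (auto simp: S_def r0_def)
  have x0_notin: "x0 \<notin> span B"
  proof
    assume "x0 \<in> span B"
    then have "x0 - 0 *\<^sub>R d \<in> span D" using B(4) by simp
    from coeff_unique[OF x0(4) this] show False using x0(1) by simp
  qed
  then have x0B: "x0 \<notin> B" by (auto intro: span_base)
  let ?B = "insert x0 B"
  have span_D: "span D \<subseteq> span ?B" using B(4) span_mono[of B ?B] by blast
  have "x0 \<in> span ?B" by (auto intro: span_base)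
  have "span ?B = span (insert d D)"
  proof
    have "x0 \<in> span (insert d D)" using x0(4) by (auto simp: span_breakdown_eq)
    moreover have "B \<subseteq> span (insert d D)"
      using B(4) span_mono[of D "insert d D"] span_superset[of B] by blast
    ultimately show "span ?B \<subseteq> span (insert d D)" by (intro span_minimal) auto
    have "r0 *\<^sub>R d \<in> span ?B"
      using span_diff[OF \<open>x0 \<in> span ?B\<close> subsetD[OF span_D x0(4)]] by simp
    from span_scale[OF this, of "1 / r0"] have "d \<in> span ?B" using x0(1) by simp
    moreover have "D \<subseteq> span ?B" using span_D span_superset[of D] by blast
    ultimately show "span (insert d D) \<subseteq> span ?B" by (intro span_minimal) auto
  qed
  moreover have "T \<inter> span (insert d D) = int_combinations ?B"
  proof
    show "int_combinations ?B \<subseteq> T \<inter> span (insert d D)"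
    proof
      fix z assume "z \<in> int_combinations ?B"
      then obtain k where k: "z = (\<Sum>b\<in>?B. of_int (k b) *\<^sub>R b)" by (auto simp: int_combinations_def)
      have "?B \<subseteq> T" using B(3) x0(3) by blast
      from sum_int[OF this] have "z \<in> T" unfolding k .
      moreover have "z \<in> span ?B" unfolding k by (intro span_sum span_scale span_base)
      ultimately show "z \<in> T \<inter> span (insert d D)" using \<open>span ?B = span (insert d D)\<close> by blast
    qed
    show "T \<inter> span (insert d D) \<subseteq> int_combinations ?B"
    proof
      fix x assume x: "x \<in> T \<inter> span (insert d D)"
      then obtain r where r: "x - r *\<^sub>R d \<in> span D" by (auto simp: span_breakdown_eq)
      \<comment> \<open>Euclidean division of the coordinate by the minimal one: the remainder
        \<open>s\<close> is below \<open>r0\<close>, hence 0, and the rest lies in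
        \<open>span D\<close>.\<close>
      define n where "n = \<lfloor>r / r0\<rfloor>"
      define y where "y = x - of_int n *\<^sub>R x0"
      define s where "s = r - of_int n * r0"
      have yT: "y \<in> T" unfolding y_def using x x0(3) by (intro diff scale_int) auto
      have "y - s *\<^sub>R d = (x - r *\<^sub>R d) - of_int n *\<^sub>R (x0 - r0 *\<^sub>R d)"
        by (simp add: y_def s_def algebra_simps)
      then have ys: "y - s *\<^sub>R d \<in> span D" using span_diff[OF r span_scale[OF x0(4)]] by simp
      have "of_int n * r0 \<le> r" "r < (of_int n + 1) * r0"
        using floor_divide_lower[OF x0(1), of r] floor_divide_upper[OF x0(1), of r] by (auto simp: n_def)
      then have s: "0 \<le> s" "s < r0" by (auto simp: s_def algebra_simps)
      have "s = 0"
      proof (rule ccontr)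
        assume "s \<noteq> 0"
        then have "s \<in> S" using s x0(2) yT ys by (auto simp: S_def)
        then show False using Min_le[of s] s(2) by (simp add: r0_def)
      qed
      then have "y \<in> int_combinations B" using ys yT B(5) by auto
      then obtain k where k: "y = (\<Sum>b\<in>B. of_int (k b) *\<^sub>R b)" by (auto simp: int_combinations_def)
      let ?k = "k(x0 := n)"
      have "(\<Sum>b\<in>B. of_int (?k b) *\<^sub>R b) = y" unfolding k using x0B by (intro sum.cong) auto
      then have "x = (\<Sum>b\<in>?B. of_int (?k b) *\<^sub>R b)"
        using B(1) x0B by (simp add: y_def)
      then show "x \<in> int_combinations ?B" using int_combinationsI[of ?k ?B] by simp
    qed
  qed
  moreover have "independent ?B" using B(2) x0_notin x0B by (simp add: independent_insert)
  moreover have "finite ?B" "?B \<subseteq> T" using B(1,3) x0(3) by auto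
  ultimately show ?case by blast
qed

end

section \<open>The translation lattice of a crystallographic group\<close>

context crystallographic
begin

definition translation_vectors :: "'a set" where
  "translation_vectors = {t. translation t \<in> \<Gamma>}"

lemma translation_vectorsI: "\<gamma> \<in> \<Gamma> \<Longrightarrow> lin \<gamma> = id \<Longrightarrow> \<gamma> = translation (\<gamma> 0) \<and> \<gamma> 0 \<in> translation_vectors"
proof -
  assume \<gamma>: "\<gamma> \<in> \<Gamma>" "lin \<gamma> = id"
  have "\<gamma> x = translation (\<gamma> 0) x" for x
    using isom_affine[OF isom[OF \<gamma>(1)], of x] \<gamma>(2) by (simp add: translation_def)
  then have "\<gamma> = translation (\<gamma> 0)" by blast
  then show ?thesis using \<gamma>(1) unfolding translation_vectors_def by simp
qed

sublocale vectors: discrete_subgroup translation_vectors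
proof unfold_locales
  show "0 \<in> translation_vectors" using id_closed by (simp add: translation_vectors_def translation_0)
  show "s - t \<in> translation_vectors" if st: "s \<in> translation_vectors" "t \<in> translation_vectors" for s t
  proof -
    obtain \<delta> where \<delta>: "\<delta> \<in> \<Gamma>" "translation t \<circ> \<delta> = id"
      using obtain_inverse[of "translation t"] st(2) by (auto simp: translation_vectors_def)
    have "\<delta> = translation (- t) \<circ> (translation t \<circ> \<delta>)" by (simp add: translation_comp translation_0 o_assoc)
    then have "\<delta> = translation (- t)" using \<delta>(2) by simp
    then have "translation s \<circ> translation (- t) \<in> \<Gamma>" using comp_closed st(1) \<delta>(1) by (auto simp: translation_vectors_def)
    then show ?thesis by (simp add: translation_vectors_def translation_comp)
  qed
  show "finite {t \<in> translation_vectors. norm t \<le> R}" for R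
  proof -
    have "translation ` {t \<in> translation_vectors. norm t \<le> R} \<subseteq> {\<gamma> \<in> \<Gamma>. norm (\<gamma> 0) \<le> R}"
      by (auto simp: translation_vectors_def translation_def)
    then have "finite (translation ` {t \<in> translation_vectors. norm t \<le> R})" using finite_bounded finite_subset by blast
    then show ?thesis by (rule finite_imageD) (auto simp: inj_on_def)
  qed
qed

text \<open>Otherwise some unit vector \<open>v\<close> is orthogonal to all translation vectors. An
  almost translation along \<open>v\<close> with error 1/2 has trivial linear part, so
  \<open>\<gamma> 0\<close> is a translation vector orthogonal to \<open>v\<close>; but it also lies
  within \<open>s / 2\<close> of \<open>s *\<^sub>R v\<close>.\<close>

lemma span_translations: "span translation_vectors = UNIV"
proof (rule ccontr)
  assume "span translation_vectors \<noteq> UNIV"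
  then obtain x where x: "x \<notin> span translation_vectors" by blast
  obtain P :: "'a \<Rightarrow> 'a" where P: "linear P" "\<And>x. P x \<in> span translation_vectors"
    "\<And>x w. w \<in> span translation_vectors \<Longrightarrow> (x - P x) \<bullet> w = 0"
    using orthogonal_projection_exists[OF subspace_span] by metis
  define v where "v = (x - P x) /\<^sub>R norm (x - P x)"
  have "x - P x \<noteq> 0" using x P(2)[of x] by auto
  then have v: "norm v = 1" by (simp add: v_def)
  have orth: "v \<bullet> t = 0" if "t \<in> translation_vectors" for t
    using P(3)[OF span_base[OF that]] by (simp add: v_def)
  have half: "(1/2::real) > 0" by simp
  obtain \<gamma> s where \<gamma>: "\<gamma> \<in> \<Gamma>" "s \<ge> 1" "norm (\<gamma> 0 - s *\<^sub>R v) \<le> 1/2 * s"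
    "\<And>x. norm (lin \<gamma> x - x) \<le> 1/2 * norm x"
    using almost_translation_exists[OF v half] by metis
  have "\<gamma> 0 \<in> translation_vectors" using translation_vectorsI[OF \<gamma>(1) lin_eq_id_if_near[OF \<gamma>(1,4)]] by blast
  then have "v \<bullet> (\<gamma> 0 - s *\<^sub>R v) = - s" using orth v by (simp add: inner_diff_right dot_square_norm)
  then have "s \<le> norm (\<gamma> 0 - s *\<^sub>R v)"
    using Cauchy_Schwarz_ineq2[of v "\<gamma> 0 - s *\<^sub>R v"] v \<gamma>(2) by simp
  then show False using \<gamma>(2,3) by simp
qed

lemma obtain_int_basis:
  obtains B where "finite B" "independent B" "translation_vectors = int_combinations B"
proof -
  obtain D where D: "D \<subseteq> translation_vectors" "independent D" "translation_vectors \<subseteq> span D"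
    using maximal_independent_subset by blast
  have "finite D" using D(2) by (rule finite_independent)
  then show thesis
    using vectors.int_basis_of_span[OF _ D(2,1)] D(3) that by (metis Int_absorb2)
qed

text \<open>Conjugation acts on translations through the linear part. Normality of the translation
  subgroup and the description of its centralizer both rest on this.\<close>

lemma conj_translation:
  assumes "\<gamma> \<in> carrier G"
  shows "\<gamma> \<circ> translation t = translation (lin \<gamma> t) \<circ> \<gamma>"
  using lin_add[OF assms] by (auto simp: translation_def fun_eq_iff)

abbreviation \<Gamma>_group :: "('a \<Rightarrow> 'a) monoid" where "\<Gamma>_group \<equiv> G\<lparr>carrier := \<Gamma>\<rparr>"

lemma group_\<Gamma>: "group \<Gamma>_group"
  using group.subgroup_imp_group[OF group_isom_group subgroup_\<Gamma>] .

sublocale \<Gamma>: group \<Gamma>_group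
  by (rule group_\<Gamma>)

lemma \<Gamma>_mult: "f \<otimes>\<^bsub>\<Gamma>_group\<^esub> g = f \<circ> g" and \<Gamma>_one: "\<one>\<^bsub>\<Gamma>_group\<^esub> = id"
  by (simp_all add: isom_group_def)

lemma translation_pow: "translation t [^]\<^bsub>\<Gamma>_group\<^esub> (n::nat) = translation (real n *\<^sub>R t)"
proof (induction n)
  case 0
  then show ?case by (simp add: nat_pow_def \<Gamma>_one translation_0 one_G)
next
  case (Suc n)
  have "translation t [^]\<^bsub>\<Gamma>_group\<^esub> Suc n = translation t [^]\<^bsub>\<Gamma>_group\<^esub> n \<otimes>\<^bsub>\<Gamma>_group\<^esub> translation t"
    by (rule \<Gamma>.nat_pow_Suc)
  then show ?case unfolding Suc \<Gamma>_mult translation_comp by (simp add: algebra_simps)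
qed

lemma translation_inv:
  assumes "t \<in> translation_vectors"
  shows "inv\<^bsub>\<Gamma>_group\<^esub> (translation t) = translation (- t)"
  using assms vectors.minus[OF assms] translation_comp[of "- t" t]
  by (intro \<Gamma>.inv_equality) (auto simp: translation_vectors_def \<Gamma>_mult \<Gamma>_one translation_0 mult_G one_G)

lemma subgroup_translations:
  assumes "additive_subgroup S" "S \<subseteq> translation_vectors"
  shows "subgroup (translation ` S) \<Gamma>_group"
proof -
  interpret S: additive_subgroup S by (rule assms(1))
  show ?thesis
  proof (rule \<Gamma>.subgroupI)
    show "translation ` S \<subseteq> carrier \<Gamma>_group" using assms(2) by (auto simp: translation_vectors_def)
    show "translation ` S \<noteq> {}" using S.zero by blast
    show "inv\<^bsub>\<Gamma>_group\<^esub> f \<in> translation ` S" if "f \<in> translation ` S" for f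
      using that assms(2) translation_inv S.minus by (auto simp: subset_iff)
    show "f \<otimes>\<^bsub>\<Gamma>_group\<^esub> g \<in> translation ` S" if "f \<in> translation ` S" "g \<in> translation ` S" for f g
      using that S.add by (auto simp: mult_G translation_comp)
  qed
qed

text \<open>Two elements with linear parts within 1/2 of each other differ by a translation, so each
  element is a translation \<open>\<tau> \<gamma>\<close> after one of finitely many
  representatives. Recording the representative and the coordinates of
  \<open>\<tau> \<gamma>\<close> modulo \<open>n\<close> separates the cosets of the
  \<open>n\<close>-th powers.\<close>

lemma finite_index_translations:
  assumes n: "n > (0::nat)"
  shows "finite (rcosets\<^bsub>\<Gamma>_group\<^esub> ((\<lambda>x. x [^]\<^bsub>\<Gamma>_group\<^esub> n) ` translation ` translation_vectors))"
proof -
  define S where "S = (\<lambda>t. real n *\<^sub>R t) ` translation_vectors"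
  have S_eq: "(\<lambda>x. x [^]\<^bsub>\<Gamma>_group\<^esub> n) ` translation ` translation_vectors = translation ` S"
    by (simp add: S_def image_image translation_pow)
  have S: "additive_subgroup S"
  proof
    show "0 \<in> S" using vectors.zero by (force simp: S_def)
    show "s - t \<in> S" if "s \<in> S" "t \<in> S" for s t
      using that vectors.diff by (auto simp: S_def simp flip: scaleR_diff_right)
  qed
  have ST: "S \<subseteq> translation_vectors" using vectors.scale_nat by (auto simp: S_def)
  obtain B where B: "finite B" "independent B" "translation_vectors = int_combinations B" by (rule obtain_int_basis)
  have "\<forall>t\<in>translation_vectors. \<exists>k. t = (\<Sum>b\<in>B. of_int (k b) *\<^sub>R b)"
    unfolding B(3) by (auto simp: int_combinations_def)
  then obtain k where k: "\<And>t. t \<in> translation_vectors \<Longrightarrow> t = (\<Sum>b\<in>B. of_int (k t b) *\<^sub>R b)" by metis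
  have half: "(1/2::real) > 0" by simp
  obtain c :: "('a \<Rightarrow> 'a) \<Rightarrow> 'a \<Rightarrow> 'a" where c: "finite (c ` carrier G)"
    "\<And>f g x. f \<in> carrier G \<Longrightarrow> g \<in> carrier G \<Longrightarrow> c f = c g \<Longrightarrow> norm (lin f x - lin g x) \<le> 1/2 * norm x"
    using finite_lin_net[OF half] by metis
  \<comment> \<open>The inverse is taken on \<open>\<Gamma>\<close>, not on the full isometry group,
    so that the representatives belong to the lattice.\<close>
  define \<rho> where "\<rho> = inv_into \<Gamma> c"
  have \<rho>: "\<rho> (c \<gamma>) \<in> \<Gamma>" "c (\<rho> (c \<gamma>)) = c \<gamma>" if "\<gamma> \<in> \<Gamma>" for \<gamma>
    using that by (auto simp: \<rho>_def inv_into_into f_inv_into_f)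
  have "\<exists>t\<in>translation_vectors. \<gamma> = translation t \<circ> \<rho> (c \<gamma>)" if \<gamma>: "\<gamma> \<in> \<Gamma>" for \<gamma>
  proof -
    obtain \<delta> where \<delta>: "\<delta> \<in> \<Gamma>" "\<rho> (c \<gamma>) \<circ> \<delta> = id" "\<delta> \<circ> \<rho> (c \<gamma>) = id"
      using obtain_inverse[OF \<rho>(1)[OF \<gamma>]] by metis
    have \<gamma>\<delta>: "\<gamma> \<circ> \<delta> \<in> \<Gamma>" using comp_closed \<gamma> \<delta>(1) by blast
    have "norm (lin (\<gamma> \<circ> \<delta>) x - x) \<le> 1/2 * norm x" for x
    proof -
      have "lin (\<rho> (c \<gamma>) \<circ> \<delta>) x = x" unfolding \<delta>(2) by (simp add: lin_def)
      then have "norm (lin (\<gamma> \<circ> \<delta>) x - x) = norm (lin \<gamma> (lin \<delta> x) - lin (\<rho> (c \<gamma>)) (lin \<delta> x))"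
        by (simp only: lin_comp[OF isom[OF \<gamma>]] lin_comp[OF isom[OF \<rho>(1)[OF \<gamma>]]])
      also have "\<dots> \<le> 1/2 * norm (lin \<delta> x)"
        using c(2)[OF isom[OF \<gamma>] isom[OF \<rho>(1)[OF \<gamma>]]] \<rho>(2)[OF \<gamma>] by simp
      finally show ?thesis by (simp only: norm_lin[OF isom[OF \<delta>(1)]])
    qed
    then obtain t where t: "\<gamma> \<circ> \<delta> = translation t" "t \<in> translation_vectors"
      using translation_vectorsI[OF \<gamma>\<delta> lin_eq_id_if_near[OF \<gamma>\<delta>]] by blast
    have "\<gamma> = (\<gamma> \<circ> \<delta>) \<circ> \<rho> (c \<gamma>)" using \<delta>(3) by (simp add: o_assoc[symmetric])
    then have "\<gamma> = translation t \<circ> \<rho> (c \<gamma>)" unfolding t(1) .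
    then show ?thesis using t(2) by blast
  qed
  then obtain \<tau> where \<tau>: "\<And>\<gamma>. \<gamma> \<in> \<Gamma> \<Longrightarrow> \<tau> \<gamma> \<in> translation_vectors \<and> \<gamma> = translation (\<tau> \<gamma>) \<circ> \<rho> (c \<gamma>)" by metis
  define h where "h \<gamma> = (c \<gamma>, \<lambda>b\<in>B. k (\<tau> \<gamma>) b mod int n)" for \<gamma>
  show ?thesis
    unfolding S_eq
  proof (rule \<Gamma>.finite_rcosetsI)
    show "subgroup (translation ` S) \<Gamma>_group" using subgroup_translations[OF S ST] .
    have "h ` carrier \<Gamma>_group \<subseteq> c ` carrier G \<times> (B \<rightarrow>\<^sub>E {0..<int n})"
      using isom n by (auto simp: h_def)
    then show "finite (h ` carrier \<Gamma>_group)"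
      using c(1) B(1) finite_PiE[of B "\<lambda>_. {0..<int n}"] by (meson finite_SigmaI finite_atLeastLessThan_int finite_subset)
  next
    fix \<gamma> \<delta> assume "\<gamma> \<in> carrier \<Gamma>_group" "\<delta> \<in> carrier \<Gamma>_group" and eq: "h \<gamma> = h \<delta>"
    then have \<gamma>: "\<gamma> \<in> \<Gamma>" and \<delta>: "\<delta> \<in> \<Gamma>" by auto
    let ?s = "\<tau> \<gamma>" and ?t = "\<tau> \<delta>" and ?r = "\<rho> (c \<gamma>)"
    have ceq: "c \<gamma> = c \<delta>" using eq by (simp add: h_def)
    have s: "?s \<in> translation_vectors" "\<gamma> = translation ?s \<circ> ?r" and t: "?t \<in> translation_vectors" "\<delta> = translation ?t \<circ> ?r"
      using \<tau>[OF \<gamma>] \<tau>[OF \<delta>] ceq by auto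
    have "?s - ?t \<in> S"
    proof -
      have mod: "of_int (k ?s b) - of_int (k ?t b) = real n * of_int ((k ?s b - k ?t b) div int n)" if b: "b \<in> B" for b
      proof -
        have "k ?s b mod int n = k ?t b mod int n"
          using eq b by (auto simp: h_def fun_eq_iff split: if_splits)
        then have "int n dvd k ?s b - k ?t b" by (rule mod_eq_dvd_iff[THEN iffD1])
        then have "int n * ((k ?s b - k ?t b) div int n) = k ?s b - k ?t b" by simp
        from arg_cong[OF this, of real_of_int] show ?thesis by simp
      qed
      let ?q = "\<Sum>b\<in>B. of_int ((k ?s b - k ?t b) div int n) *\<^sub>R b"
      have "?s - ?t = (\<Sum>b\<in>B. (of_int (k ?s b) - of_int (k ?t b)) *\<^sub>R b)"
        using k[OF s(1)] k[OF t(1)] by (simp add: scaleR_diff_left sum_subtractf)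
      also have "\<dots> = real n *\<^sub>R ?q"
        unfolding scaleR_sum_right by (rule sum.cong) (simp_all only: mod scaleR_scaleR)
      finally have "?s - ?t = real n *\<^sub>R ?q" .
      moreover have "?q \<in> translation_vectors" unfolding B(3) by (rule int_combinationsI)
      ultimately show ?thesis unfolding S_def by blast
    qed
    moreover have "\<gamma> \<otimes>\<^bsub>\<Gamma>_group\<^esub> inv\<^bsub>\<Gamma>_group\<^esub> \<delta> = translation (?s - ?t)"
    proof -
      have "\<gamma> = translation (?s - ?t) \<otimes>\<^bsub>\<Gamma>_group\<^esub> \<delta>"
        unfolding \<Gamma>_mult using s(2) t(2) by (metis diff_add_cancel o_assoc translation_comp)
      then show ?thesis
        using \<gamma> \<delta> vectors.diff[OF s(1) t(1)]
        by (subst \<Gamma>.inv_solve_right'[of "translation (?s - ?t)"]) (auto simp: translation_vectors_def)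
    qed
    ultimately show "\<gamma> \<otimes>\<^bsub>\<Gamma>_group\<^esub> inv\<^bsub>\<Gamma>_group\<^esub> \<delta> \<in> translation ` S" by simp
  qed
qed

lemma free_abelian_if_all_translations:
  assumes "\<Gamma> = translation ` translation_vectors"
  shows "free_abelian \<Gamma>_group"
proof -
  obtain B where B: "finite B" "independent B" "translation_vectors = int_combinations B" by (rule obtain_int_basis)
  \<comment> \<open>\<open>free_abelian\<close> indexes the basis by elements of the type of the
    group, so basis vectors are replaced by the translations along them.\<close>
  define S where "S = translation ` B"
  define q where "q x = (\<Sum>b\<in>B. of_int (poly_mapping.lookup x (translation b)) *\<^sub>R b)" for x :: "('a \<Rightarrow> 'a) \<Rightarrow>\<^sub>0 int"
  have q_add: "q (x + y) = q x + q y" for x y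
    by (simp add: q_def lookup_add scaleR_add_left sum.distrib)
  have q_translations: "q x \<in> translation_vectors" for x
    unfolding B(3) q_def by (rule int_combinationsI)
  have "bij_betw (\<lambda>x. translation (q x)) (carrier (free_Abelian_group S)) \<Gamma>"
    unfolding bij_betw_def
  proof
    show "inj_on (\<lambda>x. translation (q x)) (carrier (free_Abelian_group S))"
    proof (rule inj_onI)
      fix x y assume xy: "x \<in> carrier (free_Abelian_group S)" "y \<in> carrier (free_Abelian_group S)"
        and "translation (q x) = translation (q y)"
      then have "q x - q y = 0" by simp
      then have zero: "(\<Sum>b\<in>B. (of_int (poly_mapping.lookup x (translation b)) - of_int (poly_mapping.lookup y (translation b))) *\<^sub>R b) = 0"
        by (simp add: q_def scaleR_diff_left sum_subtractf)
      have "poly_mapping.lookup x (translation b) = poly_mapping.lookup y (translation b)" if "b \<in> B" for b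
        using independentD[OF B(2,1) order_refl zero that] by simp
      moreover have "poly_mapping.lookup x f = poly_mapping.lookup y f" if "f \<notin> S" for f
        using xy that by (metis carrier_free_Abelian_group_iff in_keys_iff subsetD)
      ultimately show "x = y" by (intro poly_mapping_eqI) (metis S_def imageE)
    qed
    show "(\<lambda>x. translation (q x)) ` carrier (free_Abelian_group S) = \<Gamma>"
    proof
      show "(\<lambda>x. translation (q x)) ` carrier (free_Abelian_group S) \<subseteq> \<Gamma>"
        using q_translations by (auto simp: translation_vectors_def)
      show "\<Gamma> \<subseteq> (\<lambda>x. translation (q x)) ` carrier (free_Abelian_group S)"
      proof
        fix \<gamma> assume "\<gamma> \<in> \<Gamma>"
        then obtain k where k: "\<gamma> = translation (\<Sum>b\<in>B. of_int (k b) *\<^sub>R b)"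
          using assms unfolding B(3) int_combinations_def by blast
        define x where "x = (\<Sum>b\<in>B. frag_cmul (k b) (frag_of (translation b)))"
        have "poly_mapping.lookup x (translation b) = k b" if "b \<in> B" for b
        proof -
          have "poly_mapping.lookup x (translation b) = (\<Sum>c\<in>B. if c = b then k b else 0)"
            unfolding x_def lookup_sum by (rule sum.cong) auto
          then show ?thesis using B(1) that by simp
        qed
        then have "\<gamma> = translation (q x)" by (simp add: q_def k)
        moreover have "x \<in> carrier (free_Abelian_group S)"
          unfolding x_def
        proof (rule sum_closed_free_Abelian_group)
          fix b assume "b \<in> B"
          then show "frag_cmul (k b) (frag_of (translation b)) \<in> carrier (free_Abelian_group S)"
            using keys_cmul[of "k b" "frag_of (translation b)"] by (auto simp: S_def)
        qed
        ultimately show "\<gamma> \<in> (\<lambda>x. translation (q x)) ` carrier (free_Abelian_group S)" by (rule image_eqI)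
      qed
    qed
  qed
  moreover have "(\<lambda>x. translation (q x)) \<in> hom (free_Abelian_group S) \<Gamma>_group"
    using q_translations by (intro homI) (auto simp: translation_vectors_def mult_G translation_comp q_add)
  ultimately have "(\<lambda>x. translation (q x)) \<in> iso (free_Abelian_group S) \<Gamma>_group" by (simp add: iso_def)
  then have "\<Gamma>_group \<cong> free_Abelian_group S"
    using group.iso_sym[OF group_free_Abelian_group] is_isoI by blast
  then show ?thesis unfolding free_abelian_def by blast
qed

lemma exceptional_imp_free_abelian:
  assumes "exceptional \<Gamma>_group"
  shows "free_abelian \<Gamma>_group"
proof (rule free_abelian_if_all_translations)
  let ?A = "translation ` translation_vectors"
  have "?A = carrier \<Gamma>_group"
  proof (rule \<Gamma>.exceptional_imp_eq_abelian_subgroup)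
    show "subgroup ?A \<Gamma>_group"
      by (rule subgroup_translations) (unfold_locales, auto)
    show "g \<otimes>\<^bsub>\<Gamma>_group\<^esub> a \<otimes>\<^bsub>\<Gamma>_group\<^esub> inv\<^bsub>\<Gamma>_group\<^esub> g \<in> ?A" if g: "g \<in> carrier \<Gamma>_group" and a: "a \<in> ?A" for g a
    proof -
      obtain t where t: "t \<in> translation_vectors" "a = translation t" using a by blast
      have g\<Gamma>: "g \<in> \<Gamma>" using g by simp
      let ?c = "g \<otimes>\<^bsub>\<Gamma>_group\<^esub> a \<otimes>\<^bsub>\<Gamma>_group\<^esub> inv\<^bsub>\<Gamma>_group\<^esub> g"
      have c: "?c \<in> \<Gamma>" using g t \<Gamma>.m_closed \<Gamma>.inv_closed by (auto simp: translation_vectors_def)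
      have inv: "g \<circ> inv\<^bsub>\<Gamma>_group\<^esub> g = id" using \<Gamma>.r_inv[OF g] by (simp add: mult_G one_G)
      have "?c = (g \<circ> a) \<circ> inv\<^bsub>\<Gamma>_group\<^esub> g" by (simp add: mult_G)
      also have "\<dots> = translation (lin g t) \<circ> (g \<circ> inv\<^bsub>\<Gamma>_group\<^esub> g)"
        using conj_translation[OF isom[OF g\<Gamma>]] t(2) by (simp add: o_assoc)
      finally have "?c = translation (lin g t)" using inv by simp
      then show ?thesis using c by (simp add: translation_vectors_def)
    qed
    show "x \<otimes>\<^bsub>\<Gamma>_group\<^esub> y = y \<otimes>\<^bsub>\<Gamma>_group\<^esub> x" if "x \<in> ?A" "y \<in> ?A" for x y
      using that by (auto simp: mult_G translation_comp add.commute)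
    show "finite (rcosets\<^bsub>\<Gamma>_group\<^esub> ((\<lambda>x. x [^]\<^bsub>\<Gamma>_group\<^esub> n) ` ?A))" if "n > 0" for n :: nat
      using that by (rule finite_index_translations)
    show "x = \<one>\<^bsub>\<Gamma>_group\<^esub>" if "x \<in> ?A" "n > 0" "x [^]\<^bsub>\<Gamma>_group\<^esub> n = \<one>\<^bsub>\<Gamma>_group\<^esub>" for x and n :: nat
      using that by (auto simp: translation_pow one_G simp flip: translation_0)
    show "x = \<one>\<^bsub>\<Gamma>_group\<^esub>"
      if x: "x \<in> ?A" and p: "p > 1" and div: "\<And>k::nat. \<exists>y\<in>?A. x = y [^]\<^bsub>\<Gamma>_group\<^esub> (p ^ k)" for x and p :: nat
    proof (rule ccontr)
      assume x1: "x \<noteq> \<one>\<^bsub>\<Gamma>_group\<^esub>"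
      obtain t where t: "t \<in> translation_vectors" "x = translation t" using x by blast
      have t0: "t \<noteq> 0" using x1 t by (auto simp: one_G translation_0)
      have "\<exists>s\<in>translation_vectors. t = real (p ^ k) *\<^sub>R s" for k :: nat
      proof -
        obtain s where "s \<in> translation_vectors" "x = translation s [^]\<^bsub>\<Gamma>_group\<^esub> (p ^ k)" using div[of k] by blast
        then show ?thesis using t(2) by (auto simp: translation_pow)
      qed
      then obtain s where s: "\<And>k. s k \<in> translation_vectors" "\<And>k. t = real (p ^ k) *\<^sub>R s k" by metis
      \<comment> \<open>The roots of a nonzero vector for different powers of \<open>p\<close> are
        distinct and no longer than \<open>t\<close>; a ball would contain infinitely many
        translation vectors.\<close>
      have "inj s"
      proof (rule injI)
        fix i j assume "s i = s j"
        moreover have "s j \<noteq> 0" using s(2)[of j] t0 by auto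
        ultimately have "real (p ^ i) = real (p ^ j)" using s(2)[of i] s(2)[of j] by (metis scaleR_right_imp_eq)
        then show "i = j" using p by (simp add: power_inject_exp)
      qed
      moreover have "range s \<subseteq> {u \<in> translation_vectors. norm u \<le> norm t}"
      proof
        fix u assume "u \<in> range s"
        then obtain k where k: "u = s k" by blast
        have "norm (s k) * 1 \<le> norm (s k) * real (p ^ k)" using p by (intro mult_left_mono) auto
        also have "\<dots> = norm t" by (subst s(2)[of k]) simp
        finally show "u \<in> {u \<in> translation_vectors. norm u \<le> norm t}" using s(1) k by simp
      qed
      ultimately show False using vectors.finite_bounded_part finite_subset range_inj_infinite by blast
    qed
    show "g \<in> ?A" if g: "g \<in> carrier \<Gamma>_group"
      and comm: "\<And>a. a \<in> ?A \<Longrightarrow> g \<otimes>\<^bsub>\<Gamma>_group\<^esub> a = a \<otimes>\<^bsub>\<Gamma>_group\<^esub> g" for g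
    proof -
      have g\<Gamma>: "g \<in> \<Gamma>" using g by simp
      note lin_g = linear_lin[OF isom[OF g\<Gamma>]]
      \<comment> \<open>Commuting with a translation means that the linear part fixes its vector; as
        these vectors span the space, \<open>lin g\<close> is the identity.\<close>
      have fix_t: "lin g t = id t" if "t \<in> translation_vectors" for t
      proof -
        have "translation (lin g t) \<circ> g = translation t \<circ> g"
          using comm[of "translation t"] that conj_translation[OF isom[OF g\<Gamma>], of t] by (simp add: mult_G)
        from fun_cong[OF this, of 0] show ?thesis by (simp add: translation_def)
      qed
      have "lin g x = id x" for x
        using linear_eq_on[OF lin_g linear_id, of x translation_vectors] fix_t span_translations by simp
      then have "lin g = id" by blast
      from translation_vectorsI[OF g\<Gamma> this] show ?thesis by blast
    qed
    show "exceptional \<Gamma>_group" by (rule assms)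
  qed
  then show "\<Gamma> = ?A" by simp
qed

end

theorem proposition5p2:
  fixes \<Gamma> :: "('a::real_inner \<Rightarrow> 'a) set"
  assumes findim: "\<exists>B::'a set. finite B \<and> span B = UNIV"
    and lattice: "lattice_in \<Gamma> (isom_group :: ('a \<Rightarrow> 'a) monoid)"
  shows "exceptional (isom_group\<lparr>carrier := \<Gamma>\<rparr>) \<longleftrightarrow> free_abelian (isom_group\<lparr>carrier := \<Gamma>\<rparr>)"
proof -
  obtain D :: "'a set" where D: "finite D" "span D = UNIV" using findim by blast
  obtain E :: "'a set" where E: "finite E" "span E = span D" "\<And>e. e \<in> E \<Longrightarrow> norm e = 1"
    "\<And>e f. e \<in> E \<Longrightarrow> f \<in> E \<Longrightarrow> e \<noteq> f \<Longrightarrow> e \<bullet> f = 0"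
    using orthonormal_spanning_set[OF D(1)] by blast
  interpret crystallographic E \<Gamma>
    using E D(2) lattice by unfold_locales auto
  show ?thesis
    using exceptional_imp_free_abelian free_abelian_imp_exceptional[OF group_\<Gamma>] by blast
qed

end
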